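(* Given a PEPA model and numerical state $\mathbf{x}_0$, let $\{X_n(t)\}$ be the density dependent CTMCs associated with $\mathbf{x}_0$. For each $n$, let $S^n$ and $\pi^n_\infty$ be the state space and stationary distribution of $X_n$, $Q^n$ its infinitesimal generator, $Q^{*,n}$ the adjoint of $Q^n$ with respect to $\pi^n_\infty$, and $\sigma_n$ the smallest non-zero eigenvalue of $-\frac{Q^n+Q^{*,n}}{2}$. If $$\pi^n_\infty( * ):=\min_{\mathbf{x}\in S^n}\pi^n_\infty(\mathbf{x})\ \ge\ \frac{1}{\exp(O(\sqrt{\sigma_n}))}$$ for sufficiently large $n$, then $X(t)$ has a finite limit as $t\to\infty$, where $X(t)$ is the solution of the derived ODEs of the same model with $X(0)=\mathbf{x}_0$.
   Context: A PEPA model (positive real rates) has $d$ local derivatives; numerical states are $\mathbf{x}\in\mathbb{Z}_{\ge0}^d$. With $r_\alpha^{P\to Q}$ the rate of transition $P\xrightarrow{\alpha}Q$ and $r_\alpha(P)=\sum_Q r_\alpha^{P\to Q}$, labelled activities are: for individual $\alpha$, $\alpha^{P\to Q}$ with rate function $f(\mathbf{x},\alpha^{P\to Q})=\mathbf{x}[P]r_\alpha^{P\to Q}$; for shared $\alpha$ with enabling local derivatives $P_1,\dots,P_k$ (distinct component types), $\alpha^w$, $w=(P_1\to Q_1,\dots,P_k\to Q_k)$, with $f(\mathbf{x},\alpha^w)=\big(\prod_i r_\alpha^{P_i\to Q_i}/r_\alpha(P_i)\big)\min_i\{\mathbf{x}[P_i]r_\alpha(P_i)\}$. Each labelled activity $l$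 has transition vector $l\in\{-1,0,1\}^d$ ($+1$ on post set, $-1$ on pre set). Derived ODEs: $\frac{\mathrm{d}\mathbf{x}}{\mathrm{d}t}=\sum_l l f(\mathbf{x},l)$. The density dependent CTMCs associated with $\mathbf{x}_0$ are the CTMCs $X_n$ with $X_n(0)=n\mathbf{x}_0$, state space the numerical states reachable from $n\mathbf{x}_0$, and rates $q^{(n)}_{\mathbf{x},\mathbf{x}+l}=f(\mathbf{x},l)$; they are assumed irreducible and positive recurrent. The adjoint $Q^{*,n}$ is defined by $Q^{*,n}(\mathbf{y},\mathbf{x})\pi^n_\infty(\mathbf{y})=Q^n(\mathbf{x},\mathbf{y})\pi^n_\infty(\mathbf{x})$. The hypothesis means: there is a constant $C>0$ with $\pi^n_\infty( * )\ge \exp(-C\sqrt{\sigma_n})$ for all sufficiently large $n$. *)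

theory Defs
  imports "HOL-Analysis.Analysis"
begin

section \<open>Continuous-time Markov chains\<close>

text \<open>A chain is given by its initial state, its state space and its transition rates. The entries
  \<open>rates c x x\<close> are irrelevant. All sums below range over \<open>states c\<close>, so the notions are meant for a
  finite state space; this is the case for every chain of a PEPA model, see \<open>finite_states_density_ctmc\<close>.\<close>

record 's ctmc =
  init :: 's
  states :: "'s set"
  rates :: "'s \<Rightarrow> 's \<Rightarrow> real"

definition exit_rate :: "'s ctmc \<Rightarrow> 's \<Rightarrow> real" where
  "exit_rate c x = (\<Sum>z\<in>states c - {x}. rates c x z)"

definition generator :: "'s ctmc \<Rightarrow> 's \<Rightarrow> 's \<Rightarrow> real" where
  "generator c x y = (if x = y then - exit_rate c x else rates c x y)"

definition irreducible_ctmc :: "'s ctmc \<Rightarrow> bool" where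
  "irreducible_ctmc c \<longleftrightarrow>
     (\<forall>x\<in>states c. \<forall>y\<in>states c.
        (\<lambda>u v. u \<in> states c \<and> v \<in> states c \<and> u \<noteq> v \<and> rates c u v > 0)\<^sup>*\<^sup>* x y)"

definition jump_prob :: "'s ctmc \<Rightarrow> 's \<Rightarrow> 's \<Rightarrow> real" where
  "jump_prob c x y =
     (if exit_rate c x = 0 then of_bool (x = y)
      else if x = y then 0 else rates c x y / exit_rate c x)"

text \<open>With \<open>Y\<close> the jump chain started in \<open>x\<close>, \<open>avoid_prob c x m y\<close> is the probability that
  \<open>Y m = y\<close> and \<open>Y i \<noteq> x\<close> for all \<open>1 \<le> i \<le> m\<close>.\<close>

primrec avoid_prob :: "'s ctmc \<Rightarrow> 's \<Rightarrow> nat \<Rightarrow> 's \<Rightarrow> real" where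
  "avoid_prob c x 0 y = of_bool (y = x)"
| "avoid_prob c x (Suc m) y =
     (if y = x then 0 else \<Sum>z\<in>states c. avoid_prob c x m z * jump_prob c z y)"

text \<open>A state is positive recurrent if it is absorbing, or if the chain returns to it almost surely
  and in finite mean time. The first series below sums the probabilities that the first return
  happens at jump \<open>m + 1\<close>. The second one is the mean return time: the \<open>m\<close>-th holding time counts
  if no return has happened by jump \<open>m\<close>, and its mean is \<open>1 / exit_rate c y\<close> given \<open>Y m = y\<close>.\<close>

definition positive_recurrent_ctmc :: "'s ctmc \<Rightarrow> bool" where
  "positive_recurrent_ctmc c \<longleftrightarrow>
     (\<forall>x\<in>states c. exit_rate c x = 0 \<or>
        ((\<lambda>m. \<Sum>y\<in>states c. avoid_prob c x m y * jump_prob c y x) sums 1 \<and>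
         summable (\<lambda>m. \<Sum>y\<in>states c. avoid_prob c x m y / exit_rate c y)))"

definition stationary_distribution :: "'s ctmc \<Rightarrow> ('s \<Rightarrow> real) \<Rightarrow> bool" where
  "stationary_distribution c p \<longleftrightarrow>
     (\<forall>x\<in>states c. 0 \<le> p x) \<and> (\<Sum>x\<in>states c. p x) = 1 \<and>
     (\<forall>y\<in>states c. (\<Sum>x\<in>states c. p x * generator c x y) = 0)"

definition is_adjoint ::
    "'s set \<Rightarrow> ('s \<Rightarrow> real) \<Rightarrow> ('s \<Rightarrow> 's \<Rightarrow> real) \<Rightarrow> ('s \<Rightarrow> 's \<Rightarrow> real) \<Rightarrow> bool" where
  "is_adjoint S p Q Qs \<longleftrightarrow> (\<forall>x\<in>S. \<forall>y\<in>S. Qs y x * p y = Q x y * p x)"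

definition eigenvalues_on :: "'s set \<Rightarrow> ('s \<Rightarrow> 's \<Rightarrow> real) \<Rightarrow> real set" where
  "eigenvalues_on S A =
     {e. \<exists>v. (\<exists>x\<in>S. v x \<noteq> 0) \<and> (\<forall>x\<in>S. (\<Sum>y\<in>S. A x y * v y) = e * v x)}"

definition smallest_nonzero_eigenvalue :: "'s set \<Rightarrow> ('s \<Rightarrow> 's \<Rightarrow> real) \<Rightarrow> real" where
  "smallest_nonzero_eigenvalue S A = Min (eigenvalues_on S A - {0})"

section \<open>PEPA models\<close>

text \<open>The type \<open>'p\<close> is the set of local derivatives, so \<open>CARD('p)\<close> is the dimension \<open>d\<close>;
  \<open>'c\<close> names the component types and \<open>'a\<close> the action types. The number \<open>rate M a P Q\<close> is the rate of
  the transition from \<open>P\<close> to \<open>Q\<close> via \<open>a\<close>, and it is \<open>0\<close> if there is no such transition. Actions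
  outside \<open>shared M\<close> are individual.\<close>

record ('p, 'a, 'c) pepa =
  comp_type :: "'p \<Rightarrow> 'c"
  shared :: "'a set"
  rate :: "'a \<Rightarrow> 'p \<Rightarrow> 'p \<Rightarrow> real"

definition enabling :: "('p, 'a, 'c) pepa \<Rightarrow> 'a \<Rightarrow> 'p set" where
  "enabling M a = {P. \<exists>Q. rate M a P Q > 0}"

definition apparent_rate :: "('p::finite, 'a, 'c) pepa \<Rightarrow> 'a \<Rightarrow> 'p \<Rightarrow> real" where
  "apparent_rate M a P = (\<Sum>Q\<in>UNIV. rate M a P Q)"

definition pepa_model :: "('p::finite, 'a, 'c) pepa \<Rightarrow> bool" where
  "pepa_model M \<longleftrightarrow>
     finite {a. enabling M a \<noteq> {}} \<and>
     (\<forall>a P Q. rate M a P Q \<ge> 0) \<and>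
     (\<forall>a P Q. rate M a P Q > 0 \<longrightarrow> comp_type M P = comp_type M Q) \<and>
     (\<forall>a\<in>shared M. inj_on (comp_type M) (enabling M a))"

text \<open>In \<open>Shared a w\<close> the tuple \<open>(P\<^sub>1 \<rightarrow> Q\<^sub>1, \<dots>, P\<^sub>k \<rightarrow> Q\<^sub>k)\<close> is given as the set of the pairs
  \<open>(P\<^sub>i, Q\<^sub>i)\<close>; its order is irrelevant since the \<open>P\<^sub>i\<close> are distinct.\<close>

datatype ('p, 'a) activity =
    Individual 'a 'p 'p
  | Shared 'a "('p \<times> 'p) set"

definition activities :: "('p, 'a, 'c) pepa \<Rightarrow> ('p, 'a) activity set" where
  "activities M =
     {Individual a P Q |a P Q. a \<notin> shared M \<and> rate M a P Q > 0} \<union>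
     {Shared a w |a w. a \<in> shared M \<and> enabling M a \<noteq> {} \<and>
        bij_betw fst w (enabling M a) \<and> (\<forall>(P, Q)\<in>w. rate M a P Q > 0)}"

primrec pre_set :: "('p, 'a) activity \<Rightarrow> 'p set" where
  "pre_set (Individual a P Q) = {P}"
| "pre_set (Shared a w) = fst ` w"

primrec post_set :: "('p, 'a) activity \<Rightarrow> 'p set" where
  "post_set (Individual a P Q) = {Q}"
| "post_set (Shared a w) = snd ` w"

text \<open>A derivative in both the pre and the post set (a self-loop) gets the entry \<open>0\<close>.\<close>

definition transition_vector :: "('p::finite, 'a) activity \<Rightarrow> int ^ 'p" where
  "transition_vector l = (\<chi> R. of_bool (R \<in> post_set l) - of_bool (R \<in> pre_set l))"

primrec rate_function ::
    "('p::finite, 'a, 'c) pepa \<Rightarrow> real ^ 'p \<Rightarrow> ('p, 'a) activity \<Rightarrow> real" where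
  "rate_function M x (Individual a P Q) = x $ P * rate M a P Q"
| "rate_function M x (Shared a w) =
     (\<Prod>(P, Q)\<in>w. rate M a P Q / apparent_rate M a P) *
     Min ((\<lambda>(P, Q). x $ P * apparent_rate M a P) ` w)"

definition real_vec :: "int ^ 'p \<Rightarrow> real ^ 'p::finite" where
  "real_vec x = (\<chi> P. real_of_int (x $ P))"

definition numerical_state :: "int ^ 'p::finite \<Rightarrow> bool" where
  "numerical_state x \<longleftrightarrow> (\<forall>P. 0 \<le> x $ P)"

definition step :: "('p::finite, 'a, 'c) pepa \<Rightarrow> int ^ 'p \<Rightarrow> int ^ 'p \<Rightarrow> bool" where
  "step M x y \<longleftrightarrow>
     (\<exists>l\<in>activities M. rate_function M (real_vec x) l > 0 \<and> y = x + transition_vector l)"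

text \<open>The rate from \<open>x\<close> to \<open>y\<close> adds up the labelled activities that lead from \<open>x\<close> to \<open>y\<close>, because
  distinct activities may have the same transition vector.\<close>

definition density_ctmc ::
    "('p::finite, 'a, 'c) pepa \<Rightarrow> int ^ 'p \<Rightarrow> nat \<Rightarrow> (int ^ 'p) ctmc" where
  "density_ctmc M x0 n =
     \<lparr>init = int n *s x0,
      states = {y. (step M)\<^sup>*\<^sup>* (int n *s x0) y},
      rates = (\<lambda>x y. \<Sum>l | l \<in> activities M \<and> x + transition_vector l = y.
                       rate_function M (real_vec x) l)\<rparr>"

definition derived_field :: "('p::finite, 'a, 'c) pepa \<Rightarrow> real ^ 'p \<Rightarrow> real ^ 'p" where
  "derived_field M x =
     (\<Sum>l\<in>activities M. rate_function M x l *\<^sub>R real_vec (transition_vector l))"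

definition solves_derived_odes ::
    "('p::finite, 'a, 'c) pepa \<Rightarrow> (real \<Rightarrow> real ^ 'p) \<Rightarrow> bool" where
  "solves_derived_odes M X \<longleftrightarrow>
     (\<forall>t\<ge>0. (X has_vector_derivative derived_field M (X t)) (at t within {0..}))"

section \<open>Finiteness\<close>

lemma finite_activities:
  fixes M :: "('p::finite, 'a, 'c) pepa"
  assumes "pepa_model M"
  shows "finite (activities M)"
proof -
  let ?A = "{a. enabling M a \<noteq> {}}"
  have fin: "finite ?A" using assms by (simp add: pepa_model_def)
  have "activities M \<subseteq> (\<lambda>(a, P, Q). Individual a P Q) ` (?A \<times> UNIV \<times> UNIV)
      \<union> (\<lambda>(a, w). Shared a w) ` (?A \<times> UNIV)"
    by (fastforce simp: activities_def enabling_def image_iff)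
  then show ?thesis using fin by (auto intro: finite_subset)
qed

lemma card_pre_post:
  fixes M :: "('p::finite, 'a, 'c) pepa"
  assumes M: "pepa_model M" and l: "l \<in> activities M"
  shows "card (pre_set l) = card (post_set l)"
proof (cases l)
  case (Individual a P Q)
  then show ?thesis by simp
next
  case (Shared a w)
  with l have w: "a \<in> shared M" "bij_betw fst w (enabling M a)" "\<forall>(P, Q)\<in>w. rate M a P Q > 0"
    by (auto simp: activities_def)
  have ct: "comp_type M (fst u) = comp_type M (snd u)" if "u \<in> w" for u
    using M w(3) that by (cases u) (auto simp: pepa_model_def)
  have inj: "inj_on (comp_type M) (enabling M a)"
    using M w(1) by (auto simp: pepa_model_def)
  have "inj_on snd w"
  proof (rule inj_onI)
    fix u v assume uv: "u \<in> w" "v \<in> w" "snd u = snd v"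
    then have "comp_type M (fst u) = comp_type M (fst v)" using ct by metis
    moreover have "fst u \<in> enabling M a" "fst v \<in> enabling M a"
      using uv w(2) by (auto simp: bij_betw_def)
    ultimately have "fst u = fst v" using inj by (auto dest: inj_onD)
    with uv show "u = v" by (simp add: prod_eq_iff)
  qed
  moreover have "inj_on fst w" using w(2) by (simp add: bij_betw_def)
  ultimately show ?thesis using Shared by (simp add: card_image)
qed

lemma sum_transition_vector:
  fixes M :: "('p::finite, 'a, 'c) pepa"
  assumes "pepa_model M" "l \<in> activities M"
  shows "(\<Sum>P\<in>UNIV. transition_vector l $ P) = 0"
  using card_pre_post[OF assms]
  by (simp add: transition_vector_def sum_subtractf of_bool_def sum.If_cases)

lemma pre_set_positive:
  fixes M :: "('p::finite, 'a, 'c) pepa"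
  assumes M: "pepa_model M" and l: "l \<in> activities M"
    and pos: "rate_function M (real_vec x) l > 0" and P: "P \<in> pre_set l"
  shows "x $ P > 0"
proof (cases l)
  case (Individual a R Q)
  then have "rate M a R Q > 0" using l by (auto simp: activities_def)
  then show ?thesis using pos P Individual by (simp add: real_vec_def zero_less_mult_iff)
next
  case (Shared a w)
  with l have w: "\<forall>(P, Q)\<in>w. rate M a P Q > 0"
    by (auto simp: activities_def)
  have app: "apparent_rate M a R \<ge> 0" for R
    using M by (auto simp: apparent_rate_def pepa_model_def intro: sum_nonneg)
  have "(\<Prod>(P, Q)\<in>w. rate M a P Q / apparent_rate M a P) \<ge> 0"
    using w app by (intro prod_nonneg) (fastforce intro: divide_nonneg_nonneg less_imp_le)
  then have mp: "Min ((\<lambda>(P, Q). real_vec x $ P * apparent_rate M a P) ` w) > 0"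
    using pos Shared by (auto simp: zero_less_mult_iff)
  obtain Q where Q: "(P, Q) \<in> w" using P Shared by auto
  have fin: "finite w" by simp
  have "Min ((\<lambda>(P, Q). real_vec x $ P * apparent_rate M a P) ` w) \<le>
      real_vec x $ P * apparent_rate M a P"
    using Q fin by (intro Min_le) (auto simp: image_iff intro!: bexI[of _ "(P, Q)"])
  then have "real_vec x $ P * apparent_rate M a P > 0" using mp by linarith
  then have "real_vec x $ P > 0" using app[of P] by (auto simp: zero_less_mult_iff)
  then show ?thesis by (simp add: real_vec_def)
qed

lemma reachable_invariant:
  fixes M :: "('p::finite, 'a, 'c) pepa"
  assumes M: "pepa_model M" and "(step M)\<^sup>*\<^sup>* x y" "numerical_state x"
  shows "numerical_state y \<and> (\<Sum>P\<in>UNIV. y $ P) = (\<Sum>P\<in>UNIV. x $ P)"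
  using assms(2)
proof (induction rule: rtranclp_induct)
  case base
  then show ?case using assms(3) by simp
next
  case (step y z)
  then obtain l where l: "l \<in> activities M" "rate_function M (real_vec y) l > 0"
    "z = y + transition_vector l" by (auto simp: step_def)
  have "0 \<le> z $ P" for P
  proof -
    have "0 \<le> y $ P" using step.IH by (simp add: numerical_state_def)
    then show ?thesis using pre_set_positive[OF M l(1,2), of P] l(3)
      by (auto simp: transition_vector_def)
  qed
  then show ?case using step.IH l(3) sum_transition_vector[OF M l(1)]
    by (simp add: numerical_state_def sum.distrib)
qed

lemma finite_states_density_ctmc:
  fixes M :: "('p::finite, 'a, 'c) pepa"
  assumes M: "pepa_model M" and x0: "numerical_state x0"
  shows "finite (states (density_ctmc M x0 n))"
proof -
  define N where "N = (\<Sum>P\<in>UNIV. (int n *s x0) $ P)"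
  have ns: "numerical_state (int n *s x0)" using x0 by (simp add: numerical_state_def)
  have "states (density_ctmc M x0 n) \<subseteq> {y. \<forall>P. y $ P \<in> {0..N}}"
  proof (clarsimp simp: density_ctmc_def)
    fix y P assume "(step M)\<^sup>*\<^sup>* (int n *s x0) y"
    from reachable_invariant[OF M this ns]
    have y: "numerical_state y" "(\<Sum>P\<in>UNIV. y $ P) = N" by (auto simp: N_def)
    then have "y $ P \<le> (\<Sum>P\<in>UNIV. y $ P)"
      by (intro member_le_sum) (auto simp: numerical_state_def)
    then show "0 \<le> y $ P \<and> y $ P \<le> N" using y by (simp add: numerical_state_def)
  qed
  moreover have "finite {y :: int ^ 'p. \<forall>P. y $ P \<in> {0..N}}"
  proof (rule finite_subset)
    show "{y :: int ^ 'p. \<forall>P. y $ P \<in> {0..N}} \<subseteq> vec_lambda ` (UNIV \<rightarrow>\<^sub>E {0..N})"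
      by (auto simp: image_iff PiE_UNIV_domain intro!: bexI[of _ "vec_nth _"])
    show "finite ((vec_lambda :: _ \<Rightarrow> int ^ 'p) ` (UNIV \<rightarrow>\<^sub>E {0..N}))"
      by (intro finite_imageI finite_PiE) auto
  qed
  ultimately show ?thesis by (rule finite_subset)
qed

end

theory Submission
  imports Defs
begin

text \<open>The hypothesis is so strong that \<open>X\<close> is constant. Suppose that the derived field \<open>u\<close> does
  not vanish at \<open>x0\<close>, and follow the linear functional \<open>u\<close> along the discrete chain with kernel
  \<open>1 + h Q\<close>, where \<open>h\<close> is of order \<open>1 / n\<close>, started in \<open>n x0\<close>. Its mean grows linearly up to some
  small macroscopic time \<open>\<tau>\<close>, but by the Poincare inequality it approaches its stationary mean with
  error \<open>n exp (O(sqrt \<sigma>) - \<tau> \<sigma>)\<close>, so \<open>\<sigma>\<close> is bounded for infinitely many \<open>n\<close>. For these \<open>n\<close> the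
  stationary probabilities are bounded away from \<open>0\<close>, so the number of states is bounded, whereas
  repeating one activity gives more than \<open>n\<close> states. So \<open>x0\<close> is an equilibrium, and \<open>X\<close> stays there.\<close>

section \<open>Spectral gap of a symmetric kernel\<close>

text \<open>The rates are homogeneous of degree one, so the drift of the functional and its size on
  the state space are both of order \<open>n\<close>. Hence \<open>n\<close> cancels when growth is
  compared with relaxation: a fixed positive number is bounded by a constant times
  \<open>exp (C * sqrt \<sigma> - \<tau> * \<sigma>)\<close>. The factor
  \<open>exp (C * sqrt \<sigma>)\<close> is the price of passing from the variance to one single
  state, whose stationary weight may be small. The stationary mean is unknown, so the mean at one
  time is compared with the mean at another.

  The obstacle is that \<open>Q\<close> need not be reversible and then offers no orthogonal
  eigenbasis. Only its quadratic form agrees with that of the symmetric part. Contraction is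
  therefore read off from the Dirichlet form, one step of \<open>1 + h Q\<close> at a time, and no
  matrix exponential occurs. On a linear functional the generator acts exactly as the derived field,
  so no fluid limit enters, only a bound on the mean distance from the initial state.\<close>

definition weighted_inner :: "'s set \<Rightarrow> ('s \<Rightarrow> real) \<Rightarrow> ('s \<Rightarrow> real) \<Rightarrow> ('s \<Rightarrow> real) \<Rightarrow> real" where
  "weighted_inner S p f g = (\<Sum>x\<in>S. p x * f x * g x)"

lemma weighted_inner_commute: "weighted_inner S p f g = weighted_inner S p g f"
  by (simp add: weighted_inner_def mult_ac)

lemma weighted_inner_add_right:
  "weighted_inner S p f (\<lambda>x. g x + h x) = weighted_inner S p f g + weighted_inner S p f h"
  by (simp add: weighted_inner_def sum.distrib algebra_simps)

lemma weighted_inner_add_left: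
  "weighted_inner S p (\<lambda>x. f x + g x) h = weighted_inner S p f h + weighted_inner S p g h"
  by (simp add: weighted_inner_def sum.distrib algebra_simps)

lemma weighted_inner_scale_right:
  "weighted_inner S p f (\<lambda>x. c * g x) = c * weighted_inner S p f g"
  by (simp add: weighted_inner_def sum_distrib_left mult_ac)

lemma weighted_inner_scale_left:
  "weighted_inner S p (\<lambda>x. c * f x) g = c * weighted_inner S p f g"
  by (simp add: weighted_inner_def sum_distrib_left mult_ac)

lemmas weighted_inner_linear = weighted_inner_add_left weighted_inner_add_right
  weighted_inner_scale_left weighted_inner_scale_right

definition kernel_op :: "'s set \<Rightarrow> ('s \<Rightarrow> 's \<Rightarrow> real) \<Rightarrow> ('s \<Rightarrow> real) \<Rightarrow> 's \<Rightarrow> real" where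
  "kernel_op S A f x = (\<Sum>y\<in>S. A x y * f y)"

lemma kernel_op_add: "kernel_op S A (\<lambda>x. f x + g x) = (\<lambda>x. kernel_op S A f x + kernel_op S A g x)"
  by (simp add: kernel_op_def sum.distrib algebra_simps fun_eq_iff)

lemma kernel_op_scale: "kernel_op S A (\<lambda>x. c * f x) = (\<lambda>x. c * kernel_op S A f x)"
  by (simp add: kernel_op_def sum_distrib_left mult_ac fun_eq_iff)

lemma weighted_inner_self_pos:
  assumes "finite S" "\<And>x. x \<in> S \<Longrightarrow> 0 < p x" "\<exists>x\<in>S. f x \<noteq> 0"
  shows "0 < weighted_inner S p f f"
proof -
  obtain x where x: "x \<in> S" "f x \<noteq> 0" using assms(3) by blast
  then have "0 < p x * f x * f x" using assms(2)[OF x(1)]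
    by (metis mult.assoc mult_pos_pos not_real_square_gt_zero)
  moreover have "0 \<le> p y * f y * f y" if "y \<in> S" for y
    using assms(2)[OF that] by (simp add: mult.assoc)
  ultimately show ?thesis unfolding weighted_inner_def
    using assms(1) x(1) by (intro sum_pos2[of S x]) auto
qed

lemma weighted_inner_self_nonneg:
  assumes "\<And>x. x \<in> S \<Longrightarrow> 0 < p x"
  shows "0 \<le> weighted_inner S p f f"
  unfolding weighted_inner_def using assms by (intro sum_nonneg) (simp add: mult.assoc less_imp_le)

text \<open>This is detailed balance; it makes sense without any sign or row sum condition on
  \<open>A\<close>.\<close>

definition symmetric_kernel :: "'s set \<Rightarrow> ('s \<Rightarrow> real) \<Rightarrow> ('s \<Rightarrow> 's \<Rightarrow> real) \<Rightarrow> bool" where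
  "symmetric_kernel S p A \<longleftrightarrow> (\<forall>x\<in>S. \<forall>y\<in>S. p x * A x y = p y * A y x)"

lemma symmetric_kernel_adjoint:
  assumes "symmetric_kernel S p A"
  shows "weighted_inner S p f (kernel_op S A g) = weighted_inner S p (kernel_op S A f) g"
proof -
  have "weighted_inner S p f (kernel_op S A g) = (\<Sum>x\<in>S. \<Sum>y\<in>S. p x * A x y * f x * g y)"
    by (simp add: weighted_inner_def kernel_op_def sum_distrib_left mult_ac)
  also have "\<dots> = (\<Sum>x\<in>S. \<Sum>y\<in>S. p y * A y x * f x * g y)"
    using assms by (intro sum.cong) (auto simp: symmetric_kernel_def)
  also have "\<dots> = (\<Sum>y\<in>S. \<Sum>x\<in>S. p y * A y x * f x * g y)"
    by (rule sum.swap)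
  also have "\<dots> = weighted_inner S p (kernel_op S A f) g"
    by (simp add: weighted_inner_def kernel_op_def sum_distrib_left sum_distrib_right mult_ac)
  finally show ?thesis .
qed

text \<open>Eigenvectors for distinct eigenvalues are orthogonal; Bessel's inequality for the point
  masses, summed over all points, bounds their number by \<open>card S\<close>.\<close>

lemma finite_eigenvalues_on:
  assumes S: "finite S" and p: "\<And>x. x \<in> S \<Longrightarrow> 0 < p x" and sym: "symmetric_kernel S p A"
  shows "finite (eigenvalues_on S A)"
proof (rule ccontr)
  assume "infinite (eigenvalues_on S A)"
  then obtain E where E: "E \<subseteq> eigenvalues_on S A" "finite E" "card E = Suc (card S)"
    using infinite_arbitrarily_large by blast
  have "\<forall>e\<in>E. \<exists>v. (\<exists>x\<in>S. v x \<noteq> 0) \<and> (\<forall>x\<in>S. (\<Sum>y\<in>S. A x y * v y) = e * v x)"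
    using E(1) by (auto simp: eigenvalues_on_def)
  then obtain v where v: "\<And>e. e \<in> E \<Longrightarrow> \<exists>x\<in>S. v e x \<noteq> 0"
    "\<And>e x. e \<in> E \<Longrightarrow> x \<in> S \<Longrightarrow> kernel_op S A (v e) x = e * v e x"
    unfolding kernel_op_def by metis
  define N where "N e = weighted_inner S p (v e) (v e)" for e
  have N: "N e > 0" if "e \<in> E" for e
    using weighted_inner_self_pos[OF S p v(1)[OF that]] by (simp add: N_def)
  have orth: "weighted_inner S p (v e) (v e') = 0" if "e \<in> E" "e' \<in> E" "e \<noteq> e'" for e e'
  proof -
    have "e' * weighted_inner S p (v e) (v e') = weighted_inner S p (v e) (kernel_op S A (v e'))"
      using v(2) that by (simp add: weighted_inner_def sum_distrib_left mult_ac)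
    also have "\<dots> = weighted_inner S p (kernel_op S A (v e)) (v e')"
      by (rule symmetric_kernel_adjoint[OF sym])
    also have "\<dots> = e * weighted_inner S p (v e) (v e')"
      using v(2) that by (simp add: weighted_inner_def sum_distrib_left mult_ac)
    finally show ?thesis using that by simp
  qed
  have bessel: "(\<Sum>e\<in>E. p x * (v e x)\<^sup>2 / N e) \<le> 1" if x: "x \<in> S" for x
  proof -
    \<comment> \<open>\<open>d\<close> represents evaluation at \<open>x\<close>, and
      \<open>w\<close> is its orthogonal projection onto the span of the eigenvectors, with Fourier
      coefficients \<open>c\<close>.\<close>
    define c where "c e = v e x / N e" for e
    define d where "d y = (if y = x then 1 / p x else 0)" for y
    define w where "w y = (\<Sum>e\<in>E. c e * v e y)" for y
    have inner_w: "weighted_inner S p g w = (\<Sum>e\<in>E. c e * weighted_inner S p g (v e))" for g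
    proof -
      have "weighted_inner S p g w = (\<Sum>y\<in>S. \<Sum>e\<in>E. c e * (p y * g y * v e y))"
        unfolding weighted_inner_def w_def by (simp add: sum_distrib_left mult_ac)
      also have "\<dots> = (\<Sum>e\<in>E. \<Sum>y\<in>S. c e * (p y * g y * v e y))" by (rule sum.swap)
      finally show ?thesis by (simp add: weighted_inner_def sum_distrib_left)
    qed
    have inner_d: "weighted_inner S p d g = g x" for g
    proof -
      have "weighted_inner S p d g = (\<Sum>y\<in>S. if y = x then g x else 0)"
        unfolding weighted_inner_def d_def using p[OF x] by (intro sum.cong) auto
      then show ?thesis using S x by simp
    qed
    have ww: "weighted_inner S p w w = (\<Sum>e\<in>E. (v e x)\<^sup>2 / N e)"
    proof -
      have "weighted_inner S p w (v e) = v e x" if e: "e \<in> E" for e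
      proof -
        have "weighted_inner S p w (v e) = (\<Sum>e'\<in>E. c e' * weighted_inner S p (v e) (v e'))"
          by (subst weighted_inner_commute) (rule inner_w)
        also have "\<dots> = (\<Sum>e'\<in>E. if e' = e then v e x else 0)"
          using e N[OF e] orth by (intro sum.cong) (auto simp: c_def N_def)
        finally show ?thesis using E(2) e by simp
      qed
      then show ?thesis
        by (simp add: inner_w c_def power2_eq_square)
    qed
    have "0 \<le> weighted_inner S p (\<lambda>y. d y + -1 * w y) (\<lambda>y. d y + -1 * w y)"
      using p by (rule weighted_inner_self_nonneg)
    also have "\<dots> = weighted_inner S p d d - 2 * weighted_inner S p d w + weighted_inner S p w w"
      using weighted_inner_commute[of S p w d]
      by (simp only: weighted_inner_linear)
    also have "\<dots> = 1 / p x - (\<Sum>e\<in>E. (v e x)\<^sup>2 / N e)"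
      unfolding ww unfolding inner_w unfolding inner_d
      by (simp add: c_def d_def power2_eq_square)
    finally have "p x * (\<Sum>e\<in>E. (v e x)\<^sup>2 / N e) \<le> 1"
      using p[OF x] by (simp add: field_simps)
    then show ?thesis by (simp add: sum_distrib_left)
  qed
  have "(\<Sum>e\<in>E. N e / N e) = (\<Sum>e\<in>E. 1)" using N by (intro sum.cong) force+
  then have "real (card E) = (\<Sum>e\<in>E. N e / N e)" by simp
  also have "\<dots> = (\<Sum>e\<in>E. \<Sum>x\<in>S. p x * (v e x)\<^sup>2 / N e)"
    by (intro sum.cong)
      (simp_all add: N_def weighted_inner_def sum_divide_distrib[symmetric] power2_eq_square mult_ac)
  also have "\<dots> = (\<Sum>x\<in>S. \<Sum>e\<in>E. p x * (v e x)\<^sup>2 / N e)" by (rule sum.swap)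
  also have "\<dots> \<le> (\<Sum>x\<in>S. 1)" by (intro sum_mono bessel)
  finally show False using E(3) by simp
qed

text \<open>First-order condition at a minimum, in the form in which varying the Rayleigh quotient
  delivers it. The denominator \<open>\<bar>a\<bar> + 1\<close> of the witness avoids a distinction
  on the sign of \<open>a\<close>.\<close>

lemma quadratic_nonneg_imp_linear_coeff_zero:
  fixes a b :: real
  assumes "\<And>t. 0 \<le> 2 * t * b + t\<^sup>2 * a"
  shows "b = 0"
proof (rule ccontr)
  assume b: "b \<noteq> 0"
  define t where "t = - b / (\<bar>a\<bar> + 1)"
  have "2 * t * b + t\<^sup>2 * a \<le> 2 * t * b + t\<^sup>2 * (\<bar>a\<bar> + 1)"
    by (intro add_left_mono mult_left_mono) auto
  also have "\<dots> = - b\<^sup>2 / (\<bar>a\<bar> + 1)"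
    unfolding t_def by (simp add: divide_simps power2_eq_square)
  also have "\<dots> < 0" using b by (simp add: divide_neg_pos)
  finally show False using assms[of t] by simp
qed

text \<open>Tychonoff, for all functions on a possibly infinite type. The radius depends on the
  point, so values outside a finite set can be pinned to \<open>0\<close>; this replaces the passage
  to a finite-dimensional space.\<close>

lemma compact_fun_box: "compact {f :: 's \<Rightarrow> real. \<forall>x. f x \<in> {- b x..b x}}"
proof -
  have "compactin (product_topology (\<lambda>i. euclidean) UNIV) (PiE UNIV (\<lambda>x. {- b x..b x}))"
    by (subst compactin_PiE) auto
  then show ?thesis
    by (simp add: euclidean_product_topology PiE_UNIV_domain Pi_def)
qed

lemma continuous_on_coordinate: "continuous_on T (\<lambda>f :: 's \<Rightarrow> real. f x)"
  by (rule continuous_on_subset[OF continuous_on_product_coordinates subset_UNIV])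

lemma continuous_on_weighted_inner_kernel_op:
  "continuous_on T (\<lambda>f. weighted_inner S p f (kernel_op S A f))"
  unfolding weighted_inner_def kernel_op_def by (intro continuous_intros continuous_on_coordinate)

lemma continuous_on_weighted_inner: "continuous_on T (\<lambda>f. weighted_inner S p f f)"
  unfolding weighted_inner_def by (intro continuous_intros continuous_on_coordinate)

lemma continuous_on_weighted_inner_left: "continuous_on T (\<lambda>f. weighted_inner S p f g)"
  unfolding weighted_inner_def by (intro continuous_intros continuous_on_coordinate)

text \<open>The minimiser of the Rayleigh quotient on the orthogonal complement of the constants is an
  eigenvector.\<close>

lemma poincare_inequality:
  assumes S: "finite S" and p: "\<And>x. x \<in> S \<Longrightarrow> 0 < p x" and sym: "symmetric_kernel S p A"
    and rows: "\<And>x. x \<in> S \<Longrightarrow> (\<Sum>y\<in>S. A x y) = 0"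
    and nonneg: "\<And>f. 0 \<le> weighted_inner S p f (kernel_op S A f)"
    and const: "\<And>f x y. weighted_inner S p f (kernel_op S A f) = 0 \<Longrightarrow> x \<in> S \<Longrightarrow> y \<in> S \<Longrightarrow> f x = f y"
    and f: "weighted_inner S p f (\<lambda>_. 1) = 0"
  shows "smallest_nonzero_eigenvalue S A * weighted_inner S p f f
      \<le> weighted_inner S p f (kernel_op S A f)"
proof (cases "\<exists>x\<in>S. f x \<noteq> 0")
  \<comment> \<open>This case also covers a one-point \<open>S\<close>, which has no nonzero
    eigenvalue, so that the \<open>Min\<close> is unspecified.\<close>
  case False
  then have "weighted_inner S p f f = 0" by (simp add: weighted_inner_def)
  then show ?thesis using nonneg by simp
next
  case True
  define R where "R f = weighted_inner S p f (kernel_op S A f)" for f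
  define I where "I f = weighted_inner S p f f" for f
  \<comment> \<open>The box excludes no normalised function: one summand of \<open>I f = 1\<close>
    already gives \<open>p x * (f x)\<^sup>2 \<le> 1\<close>. Outside \<open>S\<close> the values
    are pinned to \<open>0\<close>, which makes \<open>T\<close> compact.\<close>
  define T where "T = {f. (\<forall>x. f x \<in> {- (if x \<in> S then 1 / sqrt (p x) else 0)..
      (if x \<in> S then 1 / sqrt (p x) else 0)})} \<inter> {f. weighted_inner S p f (\<lambda>_. 1) = 0}
      \<inter> {f. I f = 1}"
  define nrm where "nrm f x = (if x \<in> S then 1 / sqrt (I f) * f x else 0)" for f x
  have cong: "weighted_inner S p g h = weighted_inner S p g' h'"
    if "\<And>x. x \<in> S \<Longrightarrow> g x = g' x" "\<And>x. x \<in> S \<Longrightarrow> h x = h' x" for g g' h h'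
    using that by (simp add: weighted_inner_def)
  have I_pos: "I g > 0" if "\<exists>x\<in>S. g x \<noteq> 0" for g
    unfolding I_def by (rule weighted_inner_self_pos[OF S p that])
  have nrm_I: "I (nrm g) = 1" if "\<exists>x\<in>S. g x \<noteq> 0" for g
  proof -
    have "I (nrm g) = weighted_inner S p (\<lambda>x. 1 / sqrt (I g) * g x) (\<lambda>x. 1 / sqrt (I g) * g x)"
      unfolding I_def by (rule cong) (auto simp: nrm_def I_def)
    also have "\<dots> = 1 / sqrt (I g) * (1 / sqrt (I g)) * I g"
      by (simp only: weighted_inner_linear I_def)
    finally show ?thesis using I_pos[OF that] by simp
  qed
  have nrm_R: "R (nrm g) = R g / I g" if "\<exists>x\<in>S. g x \<noteq> 0" for g
  proof -
    have "kernel_op S A (nrm g) x = 1 / sqrt (I g) * kernel_op S A g x" for x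
      unfolding kernel_op_def sum_distrib_left by (intro sum.cong) (auto simp: nrm_def)
    then have "R (nrm g) = weighted_inner S p (\<lambda>x. 1 / sqrt (I g) * g x)
        (\<lambda>x. 1 / sqrt (I g) * kernel_op S A g x)"
      unfolding R_def by (intro cong) (auto simp: nrm_def)
    also have "\<dots> = 1 / sqrt (I g) * (1 / sqrt (I g)) * R g"
      by (simp only: weighted_inner_linear R_def)
    finally show ?thesis using I_pos[OF that] by simp
  qed
  have nrm_T: "nrm g \<in> T" if g: "\<exists>x\<in>S. g x \<noteq> 0" "weighted_inner S p g (\<lambda>_. 1) = 0" for g
  proof -
    have "\<bar>nrm g x\<bar> \<le> 1 / sqrt (p x)" if x: "x \<in> S" for x
    proof -
      have "p x * (nrm g x)\<^sup>2 \<le> I (nrm g)"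
        unfolding I_def weighted_inner_def power2_eq_square mult.assoc[symmetric]
        using S x by (intro member_le_sum) (auto simp: mult.assoc p less_imp_le)
      then have "(nrm g x)\<^sup>2 \<le> (1 / sqrt (p x))\<^sup>2"
        using p[OF x] nrm_I[OF g(1)] by (simp add: field_simps)
      then show ?thesis using p[OF x] abs_le_square_iff[of "nrm g x" "1 / sqrt (p x)"] by simp
    qed
    moreover have out: "nrm g x = 0" if "x \<notin> S" for x using that by (simp add: nrm_def)
    moreover have "weighted_inner S p (nrm g) (\<lambda>_. 1) = 1 / sqrt (I g) * weighted_inner S p g (\<lambda>_. 1)"
      unfolding weighted_inner_scale_left[symmetric] by (rule cong) (auto simp: nrm_def)
    ultimately show ?thesis using nrm_I[OF g(1)] g(2)
      by (auto simp: T_def abs_le_iff minus_le_iff out)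
  qed
  have "closed {f. weighted_inner S p f (\<lambda>_. 1) = 0}" "closed {f. I f = 1}"
    unfolding I_def
    using continuous_on_weighted_inner_left[of UNIV S p "\<lambda>_. 1"] continuous_on_weighted_inner[of UNIV S p]
    by (simp_all add: closed_Collect_eq)
  then have "compact T" unfolding T_def by (intro compact_Int_closed compact_fun_box)
  moreover have "T \<noteq> {}" using nrm_T[OF True f] by auto
  ultimately obtain m where m: "m \<in> T" "\<And>g. g \<in> T \<Longrightarrow> R m \<le> R g"
    using continuous_attains_inf[OF _ _ continuous_on_weighted_inner_kernel_op, of T S p A]
    unfolding R_def by metis
  have mI: "I m = 1" "weighted_inner S p m (\<lambda>_. 1) = 0" using m(1) by (auto simp: T_def)
  \<comment> \<open>Scaling extends minimality on \<open>T\<close> to all functions orthogonal to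
    the constants, which may then be varied freely.\<close>
  have min: "R m * I g \<le> R g" if "weighted_inner S p g (\<lambda>_. 1) = 0" for g
  proof (cases "\<exists>x\<in>S. g x \<noteq> 0")
    case g: True
    show ?thesis using m(2)[OF nrm_T[OF g that]] I_pos[OF g] unfolding nrm_R[OF g]
      by (simp add: field_simps)
  next
    case False
    then have "I g = 0" by (simp add: weighted_inner_def I_def)
    then show ?thesis using nonneg by (simp add: R_def)
  qed
  have A1: "weighted_inner S p (kernel_op S A m) (\<lambda>_. 1) = 0"
    unfolding symmetric_kernel_adjoint[OF sym, symmetric]
    by (simp add: weighted_inner_def kernel_op_def rows)
  have stationary: "weighted_inner S p (kernel_op S A m) g = R m * weighted_inner S p m g"
    if g: "weighted_inner S p g (\<lambda>_. 1) = 0" for g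
  proof -
    \<comment> \<open>Minimality tested at \<open>m + t * g\<close>; the terms of order zero in
      \<open>t\<close> cancel because \<open>I m = 1\<close>.\<close>
    have "0 \<le> 2 * t * (weighted_inner S p (kernel_op S A m) g - R m * weighted_inner S p m g)
        + t\<^sup>2 * (R g - R m * I g)" for t
    proof -
      let ?h = "\<lambda>x. m x + t * g x"
      have "weighted_inner S p ?h (\<lambda>_. 1) = 0" using g mI(2) by (simp only: weighted_inner_linear)
      from min[OF this] have "R m * I ?h \<le> R ?h" .
      moreover have "I ?h = 1 + 2 * t * weighted_inner S p m g + t\<^sup>2 * I g"
        unfolding mI(1)[symmetric] unfolding I_def
        using weighted_inner_commute[of S p g m]
        by (simp only: weighted_inner_linear) (simp add: algebra_simps power2_eq_square)
      moreover have "R ?h = R m + 2 * t * weighted_inner S p (kernel_op S A m) g + t\<^sup>2 * R g"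
        unfolding R_def kernel_op_add kernel_op_scale
        using weighted_inner_commute[of S p g "kernel_op S A m"]
        by (simp only: weighted_inner_linear symmetric_kernel_adjoint[OF sym, of m g])
          (simp add: algebra_simps power2_eq_square)
      ultimately show ?thesis by (simp add: algebra_simps)
    qed
    then have "weighted_inner S p (kernel_op S A m) g - R m * weighted_inner S p m g = 0"
      by (rule quadratic_nonneg_imp_linear_coeff_zero)
    then show ?thesis by simp
  qed
  have "kernel_op S A m x = R m * m x" if x: "x \<in> S" for x
  proof -
    define P where "P = (\<Sum>y\<in>S. p y)"
    have P: "P > 0" unfolding P_def using S x p by (intro sum_pos) auto
    define d where "d y = (if y = x then 1 / p x else 0)" for y
    have inner_d: "weighted_inner S p g d = g x" for g
    proof -
      have "weighted_inner S p g d = (\<Sum>y\<in>S. if y = x then g x else 0)"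
        unfolding weighted_inner_def d_def using p[OF x] by (intro sum.cong) auto
      then show ?thesis using S x by simp
    qed
    \<comment> \<open>The point mass is projected onto the complement of the constants. The
      correction is invisible, since \<open>m\<close> and \<open>kernel_op S A m\<close> are both
      orthogonal to the constants.\<close>
    let ?g = "\<lambda>y. d y + (- 1 / P) * 1"
    have "weighted_inner S p ?g (\<lambda>_. 1)
        = weighted_inner S p d (\<lambda>_. 1) - 1 / P * weighted_inner S p (\<lambda>_. 1) (\<lambda>_. 1)"
      by (simp only: weighted_inner_linear)
    also have "weighted_inner S p d (\<lambda>_. 1) = 1"
      using inner_d[of "\<lambda>_. 1"] by (simp add: weighted_inner_commute)
    also have "weighted_inner S p (\<lambda>_. 1) (\<lambda>_. 1) = P" by (simp add: weighted_inner_def P_def)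
    finally have "weighted_inner S p ?g (\<lambda>_. 1) = 0" using P by simp
    from stationary[OF this] show ?thesis
      by (simp only: weighted_inner_linear inner_d A1 mI(2)) simp
  qed
  moreover have mx: "\<exists>x\<in>S. m x \<noteq> 0"
  proof (rule ccontr)
    assume "\<not> ?thesis"
    then have "I m = 0" by (simp add: weighted_inner_def I_def)
    then show False using mI by simp
  qed
  ultimately have "R m \<in> eigenvalues_on S A" by (auto simp: eigenvalues_on_def kernel_op_def)
  \<comment> \<open>At energy zero \<open>m\<close> would be constant, and a constant orthogonal to
    the constants vanishes.\<close>
  moreover have "R m \<noteq> 0"
  proof
    assume "R m = 0"
    obtain x where x: "x \<in> S" "m x \<noteq> 0" using mx by blast
    have "m y = m x" if "y \<in> S" for y using const[of m y x] \<open>R m = 0\<close> that x(1) by (simp add: R_def)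
    then have "weighted_inner S p m (\<lambda>_. 1) = m x * (\<Sum>y\<in>S. p y)"
      by (simp add: weighted_inner_def sum_distrib_left mult_ac)
    moreover have "(\<Sum>y\<in>S. p y) > 0" using S x(1) p by (intro sum_pos) auto
    ultimately show False using mI(2) x(2) by simp
  qed
  ultimately have "smallest_nonzero_eigenvalue S A \<le> R m"
    unfolding smallest_nonzero_eigenvalue_def
    using finite_eigenvalues_on[OF S p sym] by (intro Min_le) auto
  then have "smallest_nonzero_eigenvalue S A * I f \<le> R m * I f"
    using I_pos[OF True] by (intro mult_right_mono) auto
  then show ?thesis using min[OF f] by (simp add: I_def R_def)
qed

section \<open>Relaxation of a lazy chain\<close>

text \<open>\<open>Q\<close> itself need not be reversible. \<open>Qs\<close> is the generator of
  the time-reversed chain; \<open>adjoint\<close> determines it on \<open>S\<close> because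
  \<open>p\<close> is positive there.\<close>

locale reversibilised_chain =
  fixes S :: "'s set" and p :: "'s \<Rightarrow> real" and Q Qs :: "'s \<Rightarrow> 's \<Rightarrow> real"
  assumes finite_S: "finite S"
    and p_pos: "x \<in> S \<Longrightarrow> 0 < p x"
    and p_sum: "(\<Sum>x\<in>S. p x) = 1"
    and Q_nonneg: "x \<in> S \<Longrightarrow> y \<in> S \<Longrightarrow> x \<noteq> y \<Longrightarrow> 0 \<le> Q x y"
    and Q_rows: "x \<in> S \<Longrightarrow> (\<Sum>y\<in>S. Q x y) = 0"
    and Q_stationary: "y \<in> S \<Longrightarrow> (\<Sum>x\<in>S. p x * Q x y) = 0"
    and irreducible: "x \<in> S \<Longrightarrow> y \<in> S \<Longrightarrow>
      (\<lambda>u v. u \<in> S \<and> v \<in> S \<and> u \<noteq> v \<and> 0 < Q u v)\<^sup>*\<^sup>* x y"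
    and adjoint: "is_adjoint S p Q Qs"
begin

section \<open>Dirichlet form of the additive reversibilisation\<close>

definition sym_generator :: "'s \<Rightarrow> 's \<Rightarrow> real" where
  "sym_generator x y = - ((Q x y + Qs x y) / 2)"

definition dirichlet :: "('s \<Rightarrow> real) \<Rightarrow> real" where
  "dirichlet f = weighted_inner S p f (kernel_op S sym_generator f)"

definition gap :: real where
  "gap = smallest_nonzero_eigenvalue S sym_generator"

lemma p_sym_generator:
  assumes "x \<in> S" "y \<in> S"
  shows "p x * sym_generator x y = - (p x * Q x y + p y * Q y x) / 2"
proof -
  have "p x * Qs x y = p y * Q y x"
    using adjoint assms by (simp add: is_adjoint_def mult.commute)
  then show ?thesis by (simp add: sym_generator_def algebra_simps)
qed

lemma symmetric_sym_generator: "symmetric_kernel S p sym_generator"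
  by (simp add: symmetric_kernel_def p_sym_generator algebra_simps)

text \<open>The rows of \<open>Q\<close> sum to \<open>0\<close> because \<open>Q\<close> is a
  generator, those of \<open>Qs\<close> because \<open>p\<close> is stationary.\<close>

lemma sym_generator_rows:
  assumes "x \<in> S"
  shows "(\<Sum>y\<in>S. sym_generator x y) = 0"
proof -
  have "p x * (\<Sum>y\<in>S. sym_generator x y) = (\<Sum>y\<in>S. - (p x * Q x y + p y * Q y x) / 2)"
    unfolding sum_distrib_left by (intro sum.cong refl p_sym_generator assms)
  also have "\<dots> = - (p x * (\<Sum>y\<in>S. Q x y) + (\<Sum>y\<in>S. p y * Q y x)) / 2"
    by (simp add: sum_divide_distrib[symmetric] sum_negf sum_subtractf sum_distrib_left)
  finally show ?thesis using p_pos[OF assms] Q_rows[OF assms] Q_stationary[OF assms] by simp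
qed

text \<open>The part of \<open>Q\<close> that is antisymmetric for \<open>p\<close> drops out of the
  quadratic form. This is how the gap of the symmetrised generator gains control over
  \<open>Q\<close>.\<close>

lemma dirichlet_generator: "dirichlet f = - weighted_inner S p f (kernel_op S Q f)"
proof -
  have "dirichlet f = (\<Sum>x\<in>S. \<Sum>y\<in>S. p x * sym_generator x y * (f x * f y))"
    by (simp add: dirichlet_def weighted_inner_def kernel_op_def sum_distrib_left mult_ac)
  also have "\<dots> = (\<Sum>x\<in>S. \<Sum>y\<in>S. - (p x * Q x y * f x * f y) / 2 - p y * Q y x * f y * f x / 2)"
    by (intro sum.cong refl) (simp add: p_sym_generator field_simps)
  also have "\<dots> = - (\<Sum>x\<in>S. \<Sum>y\<in>S. p x * Q x y * f x * f y) / 2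
      - (\<Sum>x\<in>S. \<Sum>y\<in>S. p y * Q y x * f y * f x) / 2"
    by (simp add: sum_subtractf sum_negf sum_divide_distrib)
  also have "(\<Sum>x\<in>S. \<Sum>y\<in>S. p y * Q y x * f y * f x) = (\<Sum>x\<in>S. \<Sum>y\<in>S. p x * Q x y * f x * f y)"
    by (rule sum.swap)
  finally show ?thesis
    by (simp add: weighted_inner_def kernel_op_def sum_distrib_left sum_negf mult_ac)
qed

text \<open>When the square is expanded, the terms in \<open>(f y)\<^sup>2\<close> vanish by
  stationarity and those in \<open>(f x)\<^sup>2\<close> by the zero row sums; the cross term
  remains. The negative diagonal entries of \<open>Q\<close> are harmless, as they meet a zero
  increment.\<close>

lemma sum_carre_du_champ: "(\<Sum>x\<in>S. \<Sum>y\<in>S. p x * Q x y * (f y - f x)\<^sup>2) = 2 * dirichlet f"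
proof -
  have "(\<Sum>x\<in>S. \<Sum>y\<in>S. p x * Q x y * (f y - f x)\<^sup>2)
      = (\<Sum>x\<in>S. \<Sum>y\<in>S. p x * Q x y * (f y)\<^sup>2 - 2 * (p x * Q x y * f x * f y) + p x * (f x)\<^sup>2 * Q x y)"
    by (intro sum.cong refl) (simp add: power2_eq_square algebra_simps)
  also have "\<dots> = (\<Sum>x\<in>S. \<Sum>y\<in>S. p x * Q x y * (f y)\<^sup>2)
      - 2 * (\<Sum>x\<in>S. \<Sum>y\<in>S. p x * Q x y * f x * f y) + (\<Sum>x\<in>S. p x * (f x)\<^sup>2 * (\<Sum>y\<in>S. Q x y))"
    by (simp add: sum_subtractf sum.distrib sum_distrib_left)
  also have "(\<Sum>x\<in>S. \<Sum>y\<in>S. p x * Q x y * (f y)\<^sup>2) = (\<Sum>y\<in>S. (\<Sum>x\<in>S. p x * Q x y) * (f y)\<^sup>2)"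
    by (subst sum.swap) (simp add: sum_distrib_right)
  finally show ?thesis
    by (simp add: Q_stationary Q_rows dirichlet_generator weighted_inner_def kernel_op_def
        sum_distrib_left mult_ac)
qed

lemma carre_du_champ_term_nonneg:
  assumes "x \<in> S" "y \<in> S"
  shows "0 \<le> p x * Q x y * (f y - f x)\<^sup>2"
  using p_pos[OF assms(1)] Q_nonneg[OF assms] by (cases "x = y") auto

lemma dirichlet_nonneg: "0 \<le> dirichlet f"
proof -
  have "0 \<le> (\<Sum>x\<in>S. \<Sum>y\<in>S. p x * Q x y * (f y - f x)\<^sup>2)"
    by (intro sum_nonneg carre_du_champ_term_nonneg)
  then show ?thesis by (simp add: sum_carre_du_champ)
qed

text \<open>A vanishing sum of nonnegative terms forces equal values across every transition of
  positive rate, and irreducibility joins any two states by such transitions.\<close>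

lemma dirichlet_zero_imp_const:
  assumes zero: "dirichlet f = 0" and xy: "x \<in> S" "y \<in> S"
  shows "f x = f y"
  using irreducible[OF xy]
proof (induction rule: rtranclp_induct)
  case base
  then show ?case by simp
next
  case (step u v)
  then have uv: "u \<in> S" "v \<in> S" "0 < Q u v" by auto
  have "(\<Sum>x\<in>S. \<Sum>y\<in>S. p x * Q x y * (f y - f x)\<^sup>2) = 0"
    using sum_carre_du_champ[of f] zero by simp
  then have "(\<Sum>y\<in>S. p u * Q u y * (f y - f u)\<^sup>2) = 0"
    using uv(1) finite_S by (subst (asm) sum_nonneg_eq_0_iff)
      (auto intro!: sum_nonneg carre_du_champ_term_nonneg)
  then have "p u * Q u v * (f v - f u)\<^sup>2 = 0"
    using uv finite_S by (subst (asm) sum_nonneg_eq_0_iff) (auto intro!: carre_du_champ_term_nonneg)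
  then show ?case using step.IH uv(3) p_pos[OF uv(1)] by simp
qed

lemma gap_poincare:
  assumes "weighted_inner S p f (\<lambda>_. 1) = 0"
  shows "gap * weighted_inner S p f f \<le> dirichlet f"
  unfolding gap_def dirichlet_def
  using finite_S p_pos symmetric_sym_generator sym_generator_rows _ _ assms
proof (rule poincare_inequality)
  show "0 \<le> weighted_inner S p f (kernel_op S sym_generator f)" for f
    using dirichlet_nonneg[of f] by (simp add: dirichlet_def)
  show "f x = f y" if "weighted_inner S p f (kernel_op S sym_generator f) = 0" "x \<in> S" "y \<in> S" for f x y
    using dirichlet_zero_imp_const[of f x y] that by (simp add: dirichlet_def)
qed

lemma kernel_op_generator_diff:
  assumes "x \<in> S"
  shows "kernel_op S Q f x = (\<Sum>y\<in>S - {x}. Q x y * (f y - f x))"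
proof -
  have "kernel_op S Q f x = (\<Sum>y\<in>S. Q x y * f y) - f x * (\<Sum>y\<in>S. Q x y)"
    using Q_rows[OF assms] by (simp add: kernel_op_def)
  also have "\<dots> = (\<Sum>y\<in>S. Q x y * (f y - f x))"
    by (simp add: sum_distrib_left sum_subtractf[symmetric] algebra_simps)
  also have "\<dots> = (\<Sum>y\<in>S - {x}. Q x y * (f y - f x))"
    using finite_S assms by (simp add: sum.remove)
  finally show ?thesis .
qed

lemma exit_rate_eq:
  assumes "x \<in> S"
  shows "(\<Sum>y\<in>S - {x}. Q x y) = - Q x x"
  using Q_rows[OF assms] finite_S assms by (simp add: sum.remove)

text \<open>Cauchy-Schwarz with the weights \<open>Q x y\<close>, \<open>y \<noteq> x\<close>, whose
  total mass is the exit rate. It serves to compare the second-order term of one step with the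
  Dirichlet form.\<close>

lemma kernel_op_generator_square_le:
  assumes x: "x \<in> S"
  shows "(kernel_op S Q f x)\<^sup>2 \<le> - Q x x * (\<Sum>y\<in>S. Q x y * (f y - f x)\<^sup>2)"
proof -
  have nn: "0 \<le> Q x y" if "y \<in> S - {x}" for y using Q_nonneg[OF x, of y] that by auto
  have "(kernel_op S Q f x)\<^sup>2 = (\<Sum>y\<in>S - {x}. sqrt (Q x y) * (sqrt (Q x y) * (f y - f x)))\<^sup>2"
    unfolding kernel_op_generator_diff[OF x] using nn
    by (simp add: mult.assoc[symmetric])
  also have "\<dots> \<le> (\<Sum>y\<in>S - {x}. (sqrt (Q x y))\<^sup>2) * (\<Sum>y\<in>S - {x}. (sqrt (Q x y) * (f y - f x))\<^sup>2)"
    by (rule Cauchy_Schwarz_ineq_sum)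
  also have "\<dots> = (\<Sum>y\<in>S - {x}. Q x y) * (\<Sum>y\<in>S - {x}. Q x y * (f y - f x)\<^sup>2)"
    using nn by (simp add: power_mult_distrib)
  also have "(\<Sum>y\<in>S - {x}. Q x y * (f y - f x)\<^sup>2) = (\<Sum>y\<in>S. Q x y * (f y - f x)\<^sup>2)"
    using finite_S x by (simp add: sum.remove)
  finally show ?thesis by (simp add: exit_rate_eq[OF x])
qed

section \<open>Mean and variance under the stationary distribution\<close>

definition mean :: "('s \<Rightarrow> real) \<Rightarrow> real" where
  "mean f = weighted_inner S p f (\<lambda>_. 1)"

definition variance :: "('s \<Rightarrow> real) \<Rightarrow> real" where
  "variance f = weighted_inner S p (\<lambda>x. f x - mean f) (\<lambda>x. f x - mean f)"

lemma variance_nonneg: "0 \<le> variance f"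
  unfolding variance_def by (intro weighted_inner_self_nonneg p_pos)

lemma mean_centred: "mean (\<lambda>x. f x - mean f) = 0"
  using p_sum by (simp add: mean_def weighted_inner_def right_diff_distrib sum_subtractf
      sum_distrib_right[symmetric])

lemma variance_le:
  assumes "\<And>x. x \<in> S \<Longrightarrow> \<bar>f x\<bar> \<le> B"
  shows "variance f \<le> B\<^sup>2"
proof -
  define m where "m = mean f"
  have "variance f = (\<Sum>x\<in>S. p x * (f x)\<^sup>2 - 2 * m * (p x * f x) + m\<^sup>2 * p x)"
    unfolding variance_def weighted_inner_def m_def[symmetric]
    by (intro sum.cong refl) (simp add: algebra_simps power2_eq_square)
  also have "\<dots> = (\<Sum>x\<in>S. p x * (f x)\<^sup>2) - 2 * m * (\<Sum>x\<in>S. p x * f x) + m\<^sup>2 * (\<Sum>x\<in>S. p x)"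
    by (simp add: sum.distrib sum_subtractf sum_distrib_left)
  also have "\<dots> = (\<Sum>x\<in>S. p x * (f x)\<^sup>2) - m\<^sup>2"
    unfolding p_sum by (simp add: m_def mean_def weighted_inner_def power2_eq_square)
  also have "\<dots> \<le> (\<Sum>x\<in>S. p x * (f x)\<^sup>2)" by simp
  also have "\<dots> \<le> (\<Sum>x\<in>S. p x * B\<^sup>2)"
    using assms p_pos by (intro sum_mono mult_left_mono) (auto simp: abs_le_square_iff[symmetric] less_imp_le
        intro: order_trans[OF _ abs_ge_self])
  also have "\<dots> = B\<^sup>2" using p_sum by (simp add: sum_distrib_right[symmetric])
  finally show ?thesis .
qed

end

text \<open>The kernel \<open>1 + h Q\<close> is stochastic for \<open>h * exit rate \<le> 1\<close>. The stronger bound \<open>1/2\<close> makes the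
  discrete chain lazy, so that one step contracts the variance by \<open>1 - h * gap\<close> without
  any assumption of reversibility.\<close>

locale lazy_chain = reversibilised_chain S p Q Qs
  for S :: "'s set" and p :: "'s \<Rightarrow> real" and Q Qs :: "'s \<Rightarrow> 's \<Rightarrow> real" +
  fixes h :: real
  assumes h_pos: "0 < h" and lazy: "x \<in> S \<Longrightarrow> h * - Q x x \<le> 1 / 2"
begin

text \<open>The operator acts on functions, so \<open>(step_op ^^ j) f x\<close> is the mean of
  \<open>f\<close> after \<open>j\<close> steps of the discrete chain from \<open>x\<close>.\<close>

definition step_op :: "('s \<Rightarrow> real) \<Rightarrow> 's \<Rightarrow> real" where
  "step_op f x = f x + h * kernel_op S Q f x"

lemma step_op_affine:
  assumes "x \<in> S"
  shows "step_op (\<lambda>y. a + b * g y) x = a + b * step_op g x"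
proof -
  have "kernel_op S Q (\<lambda>y. a + b * g y) x = a * (\<Sum>y\<in>S. Q x y) + b * kernel_op S Q g x"
    unfolding kernel_op_def by (simp add: sum.distrib sum_distrib_left algebra_simps)
  then show ?thesis using Q_rows[OF assms] by (simp add: step_op_def algebra_simps)
qed

lemma step_op_mono:
  assumes "\<And>y. y \<in> S \<Longrightarrow> f y \<le> g y" and x: "x \<in> S"
  shows "step_op f x \<le> step_op g x"
proof -
  have split: "step_op f x = (1 + h * Q x x) * f x + h * (\<Sum>y\<in>S - {x}. Q x y * f y)" for f
    using finite_S x by (simp add: step_op_def kernel_op_def sum.remove algebra_simps)
  have "0 \<le> 1 + h * Q x x" using lazy[OF x] by simp
  moreover have "(\<Sum>y\<in>S - {x}. Q x y * f y) \<le> (\<Sum>y\<in>S - {x}. Q x y * g y)"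
    using assms Q_nonneg[OF x] by (intro sum_mono mult_left_mono) auto
  ultimately show ?thesis unfolding split using assms h_pos
    by (intro add_mono mult_left_mono) auto
qed

lemma step_op_add: "step_op (\<lambda>x. f x + g x) = (\<lambda>x. step_op f x + step_op g x)"
  by (simp add: step_op_def kernel_op_add algebra_simps fun_eq_iff)

lemma funpow_step_op_add:
  "(step_op ^^ j) (\<lambda>x. f x + g x) = (\<lambda>x. (step_op ^^ j) f x + (step_op ^^ j) g x)"
  by (induction j) (simp_all add: step_op_add)

text \<open>\<open>step_op\<close> is monotone and respects affine combinations, so the bound is
  pushed through one step at a time. As \<open>b\<close> is nonnegative, slow growth of
  \<open>g\<close> turns into slow decay of the lower bound.\<close>

lemma funpow_step_op_lower:
  assumes r: "\<And>y. y \<in> S \<Longrightarrow> a - b * g y \<le> r y" and b: "0 \<le> b"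
    and g: "\<And>y. y \<in> S \<Longrightarrow> step_op g y \<le> g y + D" and x: "x \<in> S"
  shows "a - b * (g x + real i * D) \<le> (step_op ^^ i) r x"
  using x
proof (induction i arbitrary: x)
  case 0
  then show ?case using r by simp
next
  case (Suc i)
  have "a - b * (g x + real (Suc i) * D) \<le> (a - b * real i * D) + (- b) * step_op g x"
    using mult_left_mono[OF g[OF Suc.prems] b] by (simp add: algebra_simps)
  also have "\<dots> = step_op (\<lambda>y. (a - b * real i * D) + (- b) * g y) x"
    by (rule step_op_affine[symmetric, OF Suc.prems])
  also have "\<dots> \<le> step_op ((step_op ^^ i) r) x"
    using Suc.IH by (intro step_op_mono Suc.prems) (simp add: algebra_simps)
  finally show ?case by simp
qed

text \<open>Telescoping: consecutive iterates of \<open>f\<close> differ by an iterate of the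
  one-step drift \<open>h * kernel_op S Q f\<close>. Each of the \<open>m\<close> increments is
  bounded by the worst value of the bound, the one at the final time \<open>i + m\<close>.\<close>

lemma funpow_step_op_growth:
  assumes r: "\<And>y. y \<in> S \<Longrightarrow> a - b * g y \<le> h * kernel_op S Q f y" and b: "0 \<le> b"
    and g: "\<And>y. y \<in> S \<Longrightarrow> step_op g y \<le> g y + D" and D: "0 \<le> D" and x: "x \<in> S"
  shows "real m * (a - b * (g x + real (i + m) * D)) \<le> (step_op ^^ (i + m)) f x - (step_op ^^ i) f x"
proof -
  define n where "n = i + m"
  have "real k * (a - b * (g x + real n * D)) \<le> (step_op ^^ (i + k)) f x - (step_op ^^ i) f x"
    if "k \<le> m" for k
    using that
  proof (induction k)
    case 0
    then show ?case by simp
  next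
    case (Suc k)
    have "a - b * (g x + real n * D) \<le> a - b * (g x + real (i + k) * D)"
      using Suc.prems b D by (intro diff_left_mono mult_left_mono add_left_mono mult_right_mono)
        (auto simp: n_def)
    also have "\<dots> \<le> (step_op ^^ (i + k)) (\<lambda>y. h * kernel_op S Q f y) x"
      by (rule funpow_step_op_lower[OF r b g x])
    also have "\<dots> = (step_op ^^ (i + Suc k)) f x - (step_op ^^ (i + k)) f x"
    proof -
      have "(step_op ^^ (i + Suc k)) f = (step_op ^^ (i + k)) (step_op f)"
        by (simp add: funpow_Suc_right del: funpow.simps)
      also have "step_op f = (\<lambda>y. f y + h * kernel_op S Q f y)"
        by (simp add: step_op_def fun_eq_iff)
      finally show ?thesis by (simp add: funpow_step_op_add)
    qed
    finally show ?case using Suc by (simp add: algebra_simps)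
  qed
  from this[of m] show ?thesis by (simp add: n_def)
qed

lemma mean_step_op: "mean (step_op f) = mean f"
proof -
  have "(\<Sum>x\<in>S. p x * kernel_op S Q f x) = (\<Sum>x\<in>S. \<Sum>y\<in>S. p x * Q x y * f y)"
    by (simp add: kernel_op_def sum_distrib_left mult.assoc)
  also have "\<dots> = (\<Sum>y\<in>S. (\<Sum>x\<in>S. p x * Q x y) * f y)"
    by (subst sum.swap) (simp add: sum_distrib_right)
  finally have "(\<Sum>x\<in>S. p x * kernel_op S Q f x) = 0" by (simp add: Q_stationary)
  moreover have "mean (step_op f) = mean f + h * (\<Sum>x\<in>S. p x * kernel_op S Q f x)"
    by (simp add: mean_def weighted_inner_def step_op_def algebra_simps sum.distrib sum_distrib_left)
  ultimately show ?thesis by simp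
qed

text \<open>Expanding the square yields a gain \<open>2 * h * dirichlet f\<close> and a loss of
  \<open>h\<^sup>2\<close> times the squared norm of \<open>kernel_op S Q f\<close>. The bound
  \<open>1 / 2\<close> in \<open>lazy\<close> ensures that the loss uses up at most half of the
  gain.\<close>

lemma step_op_energy:
  "weighted_inner S p (step_op f) (step_op f) \<le> weighted_inner S p f f - h * dirichlet f"
proof -
  have "weighted_inner S p (kernel_op S Q f) (kernel_op S Q f) = (\<Sum>x\<in>S. p x * (kernel_op S Q f x)\<^sup>2)"
    by (simp add: weighted_inner_def power2_eq_square mult.assoc)
  also have "h * \<dots> \<le> (\<Sum>x\<in>S. 1 / 2 * (p x * (\<Sum>y\<in>S. Q x y * (f y - f x)\<^sup>2)))"
  proof (subst sum_distrib_left, intro sum_mono)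
    fix x assume x: "x \<in> S"
    define G where "G = (\<Sum>y\<in>S. Q x y * (f y - f x)\<^sup>2)"
    have G: "0 \<le> G" unfolding G_def
    proof (intro sum_nonneg)
      show "0 \<le> Q x y * (f y - f x)\<^sup>2" if "y \<in> S" for y
        using Q_nonneg[OF x that] by (cases "x = y") auto
    qed
    have "h * (kernel_op S Q f x)\<^sup>2 \<le> h * (- Q x x * G)"
      unfolding G_def using h_pos by (intro mult_left_mono kernel_op_generator_square_le x) auto
    also have "\<dots> \<le> 1 / 2 * G" using mult_right_mono[OF lazy[OF x] G] by (simp add: mult_ac)
    finally have "p x * (h * (kernel_op S Q f x)\<^sup>2) \<le> p x * (1 / 2 * G)"
      using p_pos[OF x] by (intro mult_left_mono) auto
    then show "h * (p x * (kernel_op S Q f x)\<^sup>2) \<le> 1 / 2 * (p x * (\<Sum>y\<in>S. Q x y * (f y - f x)\<^sup>2))"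
      by (simp add: G_def mult_ac)
  qed
  also have "\<dots> = dirichlet f"
    using sum_carre_du_champ[of f]
    by (simp add: sum_distrib_left[symmetric] sum_divide_distrib[symmetric] mult.assoc)
  finally have "h * weighted_inner S p (kernel_op S Q f) (kernel_op S Q f) \<le> dirichlet f" .
  then have "h * (h * weighted_inner S p (kernel_op S Q f) (kernel_op S Q f)) \<le> h * dirichlet f"
    using h_pos by (intro mult_left_mono) auto
  moreover have "weighted_inner S p (step_op f) (step_op f) = weighted_inner S p f f - 2 * h * dirichlet f
      + h * (h * weighted_inner S p (kernel_op S Q f) (kernel_op S Q f))"
    unfolding step_op_def dirichlet_generator
    using weighted_inner_commute[of S p f "kernel_op S Q f"]
    by (simp only: weighted_inner_linear)
  ultimately show ?thesis by simp
qed

text \<open>\<open>step_op\<close> fixes constants and preserves means, so it commutes with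
  centring, and the Poincare inequality applies to the centred function.\<close>

lemma variance_step_op: "variance (step_op f) \<le> (1 - h * gap) * variance f"
proof -
  let ?f = "\<lambda>x. f x - mean f"
  have "step_op f x - mean (step_op f) = step_op ?f x" if "x \<in> S" for x
    using step_op_affine[OF that, of "- mean f" 1 f] by (simp add: mean_step_op)
  then have "variance (step_op f) = weighted_inner S p (step_op ?f) (step_op ?f)"
    by (simp add: variance_def weighted_inner_def)
  also have "\<dots> \<le> weighted_inner S p ?f ?f - h * dirichlet ?f" by (rule step_op_energy)
  also have "\<dots> \<le> weighted_inner S p ?f ?f - h * (gap * weighted_inner S p ?f ?f)"
    using gap_poincare[of ?f] mean_centred[of f] h_pos
    by (intro diff_left_mono mult_left_mono) (auto simp: mean_def)
  finally show ?thesis by (simp add: variance_def algebra_simps)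
qed

lemma variance_funpow_step_op:
  "variance ((step_op ^^ j) f) \<le> exp (- gap * h * real j) * variance f"
proof (induction j)
  case 0
  then show ?case by simp
next
  case (Suc j)
  have "variance ((step_op ^^ Suc j) f) \<le> (1 - h * gap) * variance ((step_op ^^ j) f)"
    using variance_step_op by simp
  also have "\<dots> \<le> exp (- h * gap) * variance ((step_op ^^ j) f)"
    using exp_ge_add_one_self[of "- h * gap"] variance_nonneg by (intro mult_right_mono) auto
  also have "\<dots> \<le> exp (- h * gap) * (exp (- gap * h * real j) * variance f)"
    using Suc.IH by (intro mult_left_mono) auto
  also have "\<dots> = exp (- gap * h * real (Suc j)) * variance f"
  proof -
    have "- gap * h * real (Suc j) = - h * gap + - gap * h * real j" by (simp add: algebra_simps)
    then show ?thesis by (simp only: exp_add mult.assoc)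
  qed
  finally show ?case .
qed

lemma mean_funpow_step_op: "mean ((step_op ^^ j) f) = mean f"
  by (induction j) (simp_all add: mean_step_op)

text \<open>A single summand of the variance controls the deviation at \<open>x\<close>, at the
  price of the factor \<open>p x\<close>. The lower bound on the stationary distribution limits this
  price.\<close>

lemma funpow_step_op_deviation:
  assumes x: "x \<in> S" and B: "\<And>y. y \<in> S \<Longrightarrow> \<bar>f y\<bar> \<le> B"
  shows "p x * ((step_op ^^ j) f x - mean f)\<^sup>2 \<le> exp (- gap * h * real j) * B\<^sup>2"
proof -
  have "p x * ((step_op ^^ j) f x - mean f)\<^sup>2 \<le> variance ((step_op ^^ j) f)"
    unfolding variance_def weighted_inner_def mean_funpow_step_op power2_eq_square mult.assoc[symmetric]
    using finite_S x by (intro member_le_sum) (auto simp: mult.assoc p_pos less_imp_le)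
  also have "\<dots> \<le> exp (- gap * h * real j) * variance f" by (rule variance_funpow_step_op)
  also have "\<dots> \<le> exp (- gap * h * real j) * B\<^sup>2" by (intro mult_left_mono variance_le B) auto
  finally show ?thesis .
qed

end

section \<open>Chains of a PEPA model\<close>

lemma abs_Min_diff_le:
  fixes f g :: "'i \<Rightarrow> real"
  assumes "finite W" "W \<noteq> {}" "\<And>i. i \<in> W \<Longrightarrow> \<bar>f i - g i\<bar> \<le> d"
  shows "\<bar>Min (f ` W) - Min (g ` W)\<bar> \<le> d"
proof -
  have le: "Min (a ` W) \<le> Min (b ` W) + d" if ab: "\<And>i. i \<in> W \<Longrightarrow> \<bar>a i - b i\<bar> \<le> d" for a b :: "'i \<Rightarrow> real"
  proof -
    have "Min (b ` W) \<in> b ` W" using assms by (intro Min_in) auto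
    then obtain i where i: "i \<in> W" "Min (b ` W) = b i" by auto
    have "Min (a ` W) \<le> a i" using assms(1) i(1) by simp
    then show ?thesis using ab[OF i(1)] i(2) by linarith
  qed
  have "\<bar>g i - f i\<bar> \<le> d" if "i \<in> W" for i using assms(3)[OF that] by (simp add: abs_minus_commute)
  then show ?thesis using le[of f g] le[of g f] assms(3) by force
qed

lemma activities_SharedD:
  assumes "Shared a w \<in> activities M"
  shows "w \<noteq> {}" "\<And>P Q. (P, Q) \<in> w \<Longrightarrow> 0 < rate M a P Q"
  using assms by (auto simp: activities_def bij_betw_def)

lemma apparent_rate_nonneg:
  assumes "pepa_model M"
  shows "0 \<le> apparent_rate M a P"
  using assms by (auto simp: apparent_rate_def pepa_model_def intro: sum_nonneg)

lemma apparent_rate_pos: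
  assumes "pepa_model M" "0 < rate M a P Q"
  shows "0 < apparent_rate M a P"
proof -
  have "rate M a P Q \<le> apparent_rate M a P" unfolding apparent_rate_def
    using assms(1) by (intro member_le_sum) (auto simp: pepa_model_def)
  then show ?thesis using assms(2) by linarith
qed

lemma prod_rates_pos:
  assumes M: "pepa_model M" and l: "Shared a w \<in> activities M"
  shows "0 < (\<Prod>(P, Q)\<in>w. rate M a P Q / apparent_rate M a P)"
  using activities_SharedD(2)[OF l] apparent_rate_pos[OF M] by (intro prod_pos) fastforce

lemma rate_function_nonneg:
  assumes M: "pepa_model M" and l: "l \<in> activities M" and x: "\<And>P. 0 \<le> x $ P"
  shows "0 \<le> rate_function M x l"
proof (cases l)
  case (Individual a P Q)
  then show ?thesis using M x by (simp add: pepa_model_def)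
next
  case (Shared a w)
  have "0 \<le> Min ((\<lambda>(P, Q). x $ P * apparent_rate M a P) ` w)"
    using activities_SharedD(1)[of a w M] l Shared x apparent_rate_nonneg[OF M] by auto
  then show ?thesis using prod_rates_pos[OF M] l Shared by (simp add: less_imp_le)
qed

lemma rate_function_pos:
  assumes M: "pepa_model M" and l: "l \<in> activities M" and x: "\<And>P. P \<in> pre_set l \<Longrightarrow> 0 < x $ P"
  shows "0 < rate_function M x l"
proof (cases l)
  case (Individual a P Q)
  then show ?thesis using l x by (auto simp: activities_def)
next
  case (Shared a w)
  then have w: "Shared a w \<in> activities M" using l by simp
  have "0 < x $ P * apparent_rate M a P" if "(P, Q) \<in> w" for P Q
    using apparent_rate_pos[OF M activities_SharedD(2)[OF w that]] x[of P] that Shared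
    by (force intro: mult_pos_pos)
  then have "0 < Min ((\<lambda>(P, Q). x $ P * apparent_rate M a P) ` w)"
    using activities_SharedD(1)[OF w] by auto
  then show ?thesis using prod_rates_pos[OF M w] Shared by simp
qed

text \<open>Homogeneity makes the drift at \<open>n x0\<close> exactly \<open>n\<close> times the
  drift at \<open>x0\<close>.\<close>

lemma rate_function_scaleR:
  assumes l: "l \<in> activities M" and c: "0 \<le> c"
  shows "rate_function M (c *\<^sub>R x) l = c * rate_function M x l"
proof (cases l)
  case (Individual a P Q)
  then show ?thesis by simp
next
  case (Shared a w)
  let ?F = "\<lambda>(P, Q). x $ P * apparent_rate M a P"
  have "c * Min (?F ` w) = Min ((\<lambda>t. c * t) ` (?F ` w))"
    using activities_SharedD(1)[of a w M] l Shared c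
    by (intro mono_Min_commute) (auto simp: mono_def mult_left_mono)
  also have "(\<lambda>t. c * t) ` (?F ` w) = (\<lambda>(P, Q). (c *\<^sub>R x) $ P * apparent_rate M a P) ` w"
    unfolding image_image by (intro image_cong) auto
  finally show ?thesis using Shared by (simp add: algebra_simps)
qed

text \<open>The minimum of finitely many linear functions is Lipschitz. The bound holds on the whole
  space, so uniqueness for the ODE can be used without knowing that solutions stay
  nonnegative.\<close>

lemma rate_function_lipschitz:
  fixes M :: "('p::finite, 'a, 'c) pepa"
  assumes M: "pepa_model M" and l: "l \<in> activities M"
  shows "\<exists>L\<ge>0. \<forall>x y. \<bar>rate_function M x l - rate_function M y l\<bar> \<le> L * norm (x - y)"
proof (cases l)
  case (Individual a P Q)
  have "\<bar>rate_function M x l - rate_function M y l\<bar> \<le> rate M a P Q * norm (x - y)" for x y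
  proof -
    have "\<bar>rate_function M x l - rate_function M y l\<bar> = rate M a P Q * \<bar>(x - y) $ P\<bar>"
      using Individual M by (simp add: left_diff_distrib[symmetric] abs_mult pepa_model_def)
    also have "\<dots> \<le> rate M a P Q * norm (x - y)"
      using M by (intro mult_left_mono component_le_norm_cart) (simp add: pepa_model_def)
    finally show ?thesis .
  qed
  moreover have "0 \<le> rate M a P Q" using M by (simp add: pepa_model_def)
  ultimately show ?thesis by blast
next
  case (Shared a w)
  then have w: "Shared a w \<in> activities M" using l by simp
  define c where "c = (\<Prod>(P, Q)\<in>w. rate M a P Q / apparent_rate M a P)"
  define A where "A = (\<Sum>P\<in>UNIV. apparent_rate M a P)"
  have c: "0 < c" unfolding c_def by (rule prod_rates_pos[OF M w])
  have A: "0 \<le> A" unfolding A_def by (intro sum_nonneg apparent_rate_nonneg[OF M])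
  have "\<bar>rate_function M x l - rate_function M y l\<bar> \<le> (c * A) * norm (x - y)" for x y
  proof -
    let ?F = "\<lambda>x (P, Q). x $ P * apparent_rate M a P"
    have "\<bar>?F x i - ?F y i\<bar> \<le> A * norm (x - y)" for i
    proof (cases i)
      case (Pair P Q)
      have "\<bar>?F x i - ?F y i\<bar> = apparent_rate M a P * \<bar>(x - y) $ P\<bar>"
        using Pair apparent_rate_nonneg[OF M, of a P] by (simp add: left_diff_distrib[symmetric] abs_mult)
      also have "\<dots> \<le> A * norm (x - y)"
        unfolding A_def using apparent_rate_nonneg[OF M]
        by (intro mult_mono component_le_norm_cart member_le_sum) (auto intro: sum_nonneg)
      finally show ?thesis .
    qed
    then have "\<bar>Min (?F x ` w) - Min (?F y ` w)\<bar> \<le> A * norm (x - y)"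
      using activities_SharedD(1)[OF w] by (intro abs_Min_diff_le) auto
    then have "c * \<bar>Min (?F x ` w) - Min (?F y ` w)\<bar> \<le> c * (A * norm (x - y))"
      using c by (intro mult_left_mono) auto
    moreover have "rate_function M x l - rate_function M y l = c * (Min (?F x ` w) - Min (?F y ` w))"
      using Shared by (simp add: c_def right_diff_distrib)
    ultimately show ?thesis using c by (simp add: abs_mult mult.assoc)
  qed
  moreover have "0 \<le> c * A" using c A by simp
  ultimately show ?thesis by blast
qed

lemma derived_field_scaleR:
  assumes "0 \<le> c"
  shows "derived_field M (c *\<^sub>R x) = c *\<^sub>R derived_field M x"
  using assms by (simp add: derived_field_def rate_function_scaleR scaleR_sum_right)

lemma derived_field_lipschitz:
  fixes M :: "('p::finite, 'a, 'c) pepa"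
  assumes M: "pepa_model M"
  shows "\<exists>L\<ge>0. \<forall>x y. norm (derived_field M x - derived_field M y) \<le> L * norm (x - y)"
proof -
  obtain L where L: "\<And>l. l \<in> activities M \<Longrightarrow> 0 \<le> L l"
    "\<And>l x y. l \<in> activities M \<Longrightarrow> \<bar>rate_function M x l - rate_function M y l\<bar> \<le> L l * norm (x - y)"
    using rate_function_lipschitz[OF M] by metis
  have "norm (derived_field M x - derived_field M y)
      \<le> (\<Sum>l\<in>activities M. L l * norm (real_vec (transition_vector l) :: real ^ 'p)) * norm (x - y)" for x y
  proof -
    have "norm (derived_field M x - derived_field M y)
      = norm (\<Sum>l\<in>activities M.
          (rate_function M x l - rate_function M y l) *\<^sub>R real_vec (transition_vector l))"
      by (simp add: derived_field_def sum_subtractf scaleR_left_diff_distrib)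
    also have "\<dots>
        \<le> (\<Sum>l\<in>activities M. \<bar>rate_function M x l - rate_function M y l\<bar> *
            norm (real_vec (transition_vector l) :: real ^ 'p))"
      by (rule order_trans[OF norm_sum]) simp
    also have "\<dots> \<le> (\<Sum>l\<in>activities M. (L l * norm (x - y)) *
            norm (real_vec (transition_vector l) :: real ^ 'p))"
      using L(2) by (intro sum_mono mult_right_mono) auto
    finally show ?thesis by (simp add: sum_distrib_left sum_distrib_right mult_ac)
  qed
  moreover have "0 \<le> (\<Sum>l\<in>activities M. L l * norm (real_vec (transition_vector l) :: real ^ 'p))"
    using L(1) by (intro sum_nonneg) auto
  ultimately show ?thesis by blast
qed

text \<open>By homogeneity the rates vanish at the origin, so comparison with \<open>0\<close> turns
  the Lipschitz constants into linear bounds.\<close>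

lemma total_rate_le:
  fixes M :: "('p::finite, 'a, 'c) pepa"
  assumes M: "pepa_model M"
  shows "\<exists>R\<ge>0. \<forall>x. (\<Sum>l\<in>activities M. rate_function M x l) \<le> R * norm x"
proof -
  obtain L where L: "\<And>l. l \<in> activities M \<Longrightarrow> 0 \<le> L l"
    "\<And>l x y. l \<in> activities M \<Longrightarrow> \<bar>rate_function M x l - rate_function M y l\<bar> \<le> L l * norm (x - y)"
    using rate_function_lipschitz[OF M] by metis
  have "(\<Sum>l\<in>activities M. rate_function M x l) \<le> (\<Sum>l\<in>activities M. L l) * norm x" for x
    unfolding sum_distrib_right
  proof (intro sum_mono)
    fix l assume l: "l \<in> activities M"
    show "rate_function M x l \<le> L l * norm x"
      using L(2)[OF l, of x 0] rate_function_scaleR[OF l, of 0 0] by simp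
  qed
  moreover have "0 \<le> (\<Sum>l\<in>activities M. L l)" using L(1) by (intro sum_nonneg)
  ultimately show ?thesis by blast
qed

section \<open>States and generators of the density dependent chains\<close>

lemma real_vec_add: "real_vec (x + y) = real_vec x + real_vec y"
  by (simp add: real_vec_def vec_eq_iff)

lemma real_vec_smult: "real_vec (int n *s x) = real n *\<^sub>R real_vec x"
  by (simp add: real_vec_def vec_eq_iff)

lemma real_vec_nth: "real_vec x $ P = real_of_int (x $ P)"
  by (simp add: real_vec_def)

lemma states_density_ctmc_invariant:
  fixes M :: "('p::finite, 'a, 'c) pepa"
  assumes M: "pepa_model M" and x0: "numerical_state x0" and y: "y \<in> states (density_ctmc M x0 n)"
  shows "0 \<le> y $ P" and "norm (real_vec y) \<le> real n * (\<Sum>P\<in>UNIV. real_of_int (x0 $ P))"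
proof -
  have "numerical_state (int n *s x0)" using x0 by (simp add: numerical_state_def)
  then have y': "\<And>P. 0 \<le> y $ P" "(\<Sum>P\<in>UNIV. y $ P) = (\<Sum>P\<in>UNIV. (int n *s x0) $ P)"
    using reachable_invariant[OF M, of "int n *s x0" y] y
    by (auto simp: density_ctmc_def numerical_state_def)
  show "0 \<le> y $ P" by (rule y')
  have "norm (real_vec y) \<le> (\<Sum>P\<in>UNIV. \<bar>real_vec y $ P\<bar>)" by (rule norm_le_l1_cart)
  also have "\<dots> = real_of_int (\<Sum>P\<in>UNIV. y $ P)" using y'(1) by (simp add: real_vec_nth)
  also have "\<dots> = real n * (\<Sum>P\<in>UNIV. real_of_int (x0 $ P))"
    unfolding y'(2) by (simp add: sum_distrib_left)
  finally show "norm (real_vec y) \<le> real n * (\<Sum>P\<in>UNIV. real_of_int (x0 $ P))" .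
qed

lemma states_density_ctmc_step:
  assumes "y \<in> states (density_ctmc M x0 n)" "l \<in> activities M" "0 < rate_function M (real_vec y) l"
  shows "y + transition_vector l \<in> states (density_ctmc M x0 n)"
proof -
  have "step M y (y + transition_vector l)" using assms by (auto simp: step_def)
  then show ?thesis using assms(1) by (auto simp: density_ctmc_def)
qed

text \<open>Activities with a common target are grouped. An activity that would leave the state
  space has rate \<open>0\<close>, so it may be included in the sum.\<close>

lemma sum_rates_density_ctmc:
  fixes M :: "('p::finite, 'a, 'c) pepa"
  assumes M: "pepa_model M" and x0: "numerical_state x0" and y: "y \<in> states (density_ctmc M x0 n)"
  shows "(\<Sum>z\<in>states (density_ctmc M x0 n) - {y}. rates (density_ctmc M x0 n) y z * F z) =
    (\<Sum>l | l \<in> activities M \<and> y + transition_vector l \<noteq> y.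
        rate_function M (real_vec y) l * F (y + transition_vector l))"
proof -
  let ?S = "states (density_ctmc M x0 n)"
  let ?A = "{l \<in> activities M. y + transition_vector l \<in> ?S - {y}}"
  have fin: "finite ?S" "finite (activities M)"
    by (rule finite_states_density_ctmc[OF M x0], rule finite_activities[OF M])
  have "(\<Sum>z\<in>?S - {y}. rates (density_ctmc M x0 n) y z * F z) =
      (\<Sum>z\<in>?S - {y}. \<Sum>l\<in>{l \<in> ?A. y + transition_vector l = z}.
          rate_function M (real_vec y) l * F (y + transition_vector l))"
    by (intro sum.cong refl)
      (auto simp: density_ctmc_def sum_distrib_right intro!: sum.cong)
  also have "\<dots> = (\<Sum>l\<in>?A. rate_function M (real_vec y) l * F (y + transition_vector l))"
    using fin by (intro sum.group) auto
  also have "\<dots> = (\<Sum>l | l \<in> activities M \<and> y + transition_vector l \<noteq> y.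
        rate_function M (real_vec y) l * F (y + transition_vector l))"
  proof (intro sum.mono_neutral_left)
    show "\<forall>l\<in>{l. l \<in> activities M \<and> y + transition_vector l \<noteq> y} - ?A.
        rate_function M (real_vec y) l * F (y + transition_vector l) = 0"
    proof
      fix l assume l: "l \<in> {l. l \<in> activities M \<and> y + transition_vector l \<noteq> y} - ?A"
      then have "\<not> 0 < rate_function M (real_vec y) l"
        using states_density_ctmc_step[OF y, of l] by auto
      moreover have "0 \<le> rate_function M (real_vec y) l"
        using l states_density_ctmc_invariant(1)[OF M x0 y]
        by (intro rate_function_nonneg[OF M]) (auto simp: real_vec_nth)
      ultimately show "rate_function M (real_vec y) l * F (y + transition_vector l) = 0" by simp
    qed
  qed (use fin in auto)
  finally show ?thesis .
qed

lemma density_ctmc_reversibilised: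
  fixes M :: "('p::finite, 'a, 'c) pepa"
  assumes M: "pepa_model M" and x0: "numerical_state x0"
    and irr: "irreducible_ctmc (density_ctmc M x0 n)"
    and stat: "stationary_distribution (density_ctmc M x0 n) p"
    and adj: "is_adjoint (states (density_ctmc M x0 n)) p (generator (density_ctmc M x0 n)) Qs"
    and pos: "\<And>x. x \<in> states (density_ctmc M x0 n) \<Longrightarrow> 0 < p x"
  shows "reversibilised_chain (states (density_ctmc M x0 n)) p (generator (density_ctmc M x0 n)) Qs"
proof
  let ?c = "density_ctmc M x0 n"
  show fin: "finite (states ?c)" by (rule finite_states_density_ctmc[OF M x0])
  show "0 \<le> generator ?c x y" if "x \<in> states ?c" "y \<in> states ?c" "x \<noteq> y" for x y
    using that states_density_ctmc_invariant(1)[OF M x0 that(1)]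
    by (auto simp: generator_def density_ctmc_def real_vec_nth intro!: sum_nonneg rate_function_nonneg[OF M])
  show "(\<Sum>y\<in>states ?c. generator ?c x y) = 0" if "x \<in> states ?c" for x
  proof -
    have "(\<Sum>y\<in>states ?c. generator ?c x y)
        = - exit_rate ?c x + (\<Sum>y\<in>states ?c - {x}. generator ?c x y)"
      using fin that by (simp add: sum.remove generator_def)
    also have "(\<Sum>y\<in>states ?c - {x}. generator ?c x y) = exit_rate ?c x"
      unfolding exit_rate_def by (intro sum.cong) (auto simp: generator_def)
    finally show ?thesis by simp
  qed
  show "(\<lambda>u v. u \<in> states ?c \<and> v \<in> states ?c \<and> u \<noteq> v \<and> 0 < generator ?c u v)\<^sup>*\<^sup>* x y"
    if "x \<in> states ?c" "y \<in> states ?c" for x y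
  proof -
    have "(\<lambda>u v. u \<in> states ?c \<and> v \<in> states ?c \<and> u \<noteq> v \<and> 0 < generator ?c u v) =
       (\<lambda>u v. u \<in> states ?c \<and> v \<in> states ?c \<and> u \<noteq> v \<and> 0 < rates ?c u v)"
      by (auto simp: generator_def fun_eq_iff)
    then show ?thesis using irr that by (simp add: irreducible_ctmc_def)
  qed
qed (use stat adj pos in \<open>auto simp: stationary_distribution_def\<close>)

text \<open>Some activity has positive rate at \<open>x0\<close> and a nonzero vector. Each
  component in its pre set occurs at least \<open>n\<close> times in \<open>n x0\<close>, and one
  firing removes at most one of each, so it can fire \<open>n\<close> times in a row; the
  \<open>n + 1\<close> states visited lie on a line and are distinct.\<close>

lemma card_states_density_ctmc:
  fixes M :: "('p::finite, 'a, 'c) pepa"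
  assumes M: "pepa_model M" and x0: "numerical_state x0"
    and nz: "derived_field M (real_vec x0) \<noteq> 0"
  shows "n < card (states (density_ctmc M x0 n))"
proof -
  obtain l where l: "l \<in> activities M"
    "rate_function M (real_vec x0) l *\<^sub>R real_vec (transition_vector l) \<noteq> (0 :: real ^ 'p)"
    using nz unfolding derived_field_def by (meson sum.not_neutral_contains_not_neutral)
  let ?v = "transition_vector l :: int ^ 'p"
  have v: "?v \<noteq> 0" using l(2) by (auto simp: real_vec_def vec_eq_iff)
  have "0 \<le> rate_function M (real_vec x0) l"
    using x0 by (intro rate_function_nonneg[OF M l(1)]) (simp add: real_vec_nth numerical_state_def)
  then have "0 < rate_function M (real_vec x0) l" using l(2) by (auto simp: less_le)
  then have pre: "1 \<le> x0 $ P" if "P \<in> pre_set l" for P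
    using pre_set_positive[OF M l(1) _ that, of x0] by simp
  have mem: "int n *s x0 + int j *s ?v \<in> states (density_ctmc M x0 n)" if "j \<le> n" for j
    using that
  proof (induction j)
    case 0
    then show ?case by (simp add: density_ctmc_def)
  next
    case (Suc j)
    let ?y = "int n *s x0 + int j *s ?v"
    have "0 < rate_function M (real_vec ?y) l"
    proof (rule rate_function_pos[OF M l(1)])
      fix P assume P: "P \<in> pre_set l"
      have "int n * 1 \<le> int n * x0 $ P" using pre[OF P] by (intro mult_left_mono) auto
      moreover have "int j * (-1) \<le> int j * ?v $ P"
        by (intro mult_left_mono) (auto simp: transition_vector_def)
      ultimately have "0 < int n * x0 $ P + int j * ?v $ P" using Suc.prems by linarith
      then have "0 < ?y $ P" by simp
      then show "0 < real_vec ?y $ P" unfolding real_vec_nth of_int_0_less_iff .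
    qed
    then have "?y + ?v \<in> states (density_ctmc M x0 n)"
      using Suc l(1) by (intro states_density_ctmc_step) auto
    then show ?case by (simp add: vec_eq_iff algebra_simps)
  qed
  obtain P where P: "?v $ P \<noteq> 0" using v by (auto simp: vec_eq_iff)
  have "inj_on (\<lambda>j. int n *s x0 + int j *s ?v) {..n}"
    using P by (auto simp: inj_on_def vec_eq_iff)
  then have "card {..n} \<le> card (states (density_ctmc M x0 n))"
    using mem finite_states_density_ctmc[OF M x0] by (intro card_inj_on_le) auto
  then show ?thesis by simp
qed

text \<open>Gronwall: \<open>norm (X t - X 0)\<^sup>2 * exp (- 2 * L * t)\<close> does not increase.\<close>

lemma lipschitz_ode_equilibrium_const:
  fixes X :: "real \<Rightarrow> 'b::real_inner"
  assumes ode: "\<And>t. 0 \<le> t \<Longrightarrow> (X has_vector_derivative F (X t)) (at t within {0..})"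
    and lip: "\<And>x y. norm (F x - F y) \<le> L * norm (x - y)"
    and eq: "F (X 0) = 0" and t: "0 \<le> t"
  shows "X t = X 0"
proof -
  define D where "D s = X s - X 0" for s
  define G where "G s = (D s \<bullet> D s) * exp (- 2 * L * s)" for s
  have deriv: "\<exists>d. (G has_real_derivative d) (at s within {0..t}) \<and> d \<le> 0" if s: "0 \<le> s" "s \<le> t" for s
  proof -
    have "(D has_vector_derivative F (X s)) (at s within {0..t})"
      unfolding D_def using has_vector_derivative_within_subset[OF ode[OF s(1)], of "{0..t}"]
      by (auto intro!: derivative_eq_intros)
    then have D: "(D has_derivative (\<lambda>r. r *\<^sub>R F (X s))) (at s within {0..t})"
      by (simp add: has_vector_derivative_def)
    have "((\<lambda>s. D s \<bullet> D s) has_derivative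
        (\<lambda>r. D s \<bullet> (r *\<^sub>R F (X s)) + (r *\<^sub>R F (X s)) \<bullet> D s)) (at s within {0..t})"
      by (rule has_derivative_inner[OF D D])
    also have "(\<lambda>r. D s \<bullet> (r *\<^sub>R F (X s)) + (r *\<^sub>R F (X s)) \<bullet> D s) = (*) (2 * (D s \<bullet> F (X s)))"
      by (simp add: inner_commute fun_eq_iff)
    finally have "((\<lambda>s. D s \<bullet> D s) has_real_derivative 2 * (D s \<bullet> F (X s))) (at s within {0..t})"
      by (simp add: has_field_derivative_def)
    then have "(G has_real_derivative 2 * (D s \<bullet> F (X s)) * exp (- 2 * L * s) +
        (D s \<bullet> D s) * (exp (- 2 * L * s) * (- 2 * L))) (at s within {0..t})"
      unfolding G_def by (auto intro!: derivative_eq_intros)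
    moreover have "D s \<bullet> F (X s) \<le> L * (D s \<bullet> D s)"
    proof -
      have "D s \<bullet> F (X s) \<le> norm (D s) * norm (F (X s) - F (X 0))"
        using norm_cauchy_schwarz[of "D s" "F (X s)"] eq by simp
      also have "\<dots> \<le> norm (D s) * (L * norm (D s))"
        unfolding D_def by (intro mult_left_mono lip) auto
      finally show ?thesis by (simp add: dot_square_norm power2_eq_square mult_ac)
    qed
    then have "(D s \<bullet> F (X s) - L * (D s \<bullet> D s)) * (2 * exp (- 2 * L * s)) \<le> 0"
      by (intro mult_nonpos_nonneg) auto
    ultimately show ?thesis by (intro exI conjI) (auto simp: algebra_simps)
  qed
  \<comment> \<open>Inside the interval the one-sided derivatives are two-sided; at the end points
    continuity is enough.\<close>
  have "G t \<le> G 0"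
  proof (rule DERIV_nonpos_imp_decreasing_open[OF t])
    show "\<exists>d. (G has_real_derivative d) (at s) \<and> d \<le> 0" if "0 < s" "s < t" for s
      using deriv[of s] that by (simp add: at_within_Icc_at)
    show "continuous_on {0..t} G"
      unfolding continuous_on_eq_continuous_within by (meson DERIV_continuous atLeastAtMost_iff deriv)
  qed
  then have "D t \<bullet> D t \<le> 0" by (simp add: G_def D_def mult_le_0_iff)
  then have "norm (D t) = 0" by (simp add: dot_square_norm)
  then show ?thesis by (simp add: D_def)
qed

text \<open>Activities with zero vector contribute a zero increment, so the sum runs over all
  activities. For linear \<open>f\<close> the right side is \<open>f\<close> applied to the derived
  field, without any error term.\<close>

lemma generator_density_ctmc_expansion:
  fixes M :: "('p::finite, 'a, 'c) pepa"
  assumes M: "pepa_model M" and x0: "numerical_state x0"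
    and chain: "reversibilised_chain (states (density_ctmc M x0 n)) p (generator (density_ctmc M x0 n)) Qs"
    and y: "y \<in> states (density_ctmc M x0 n)"
  shows "kernel_op (states (density_ctmc M x0 n)) (generator (density_ctmc M x0 n)) f y =
    (\<Sum>l\<in>activities M. rate_function M (real_vec y) l * (f (y + transition_vector l) - f y))"
proof -
  let ?c = "density_ctmc M x0 n"
  have "kernel_op (states ?c) (generator ?c) f y
      = (\<Sum>z\<in>states ?c - {y}. generator ?c y z * (f z - f y))"
    by (rule reversibilised_chain.kernel_op_generator_diff[OF chain y])
  also have "\<dots> = (\<Sum>z\<in>states ?c - {y}. rates ?c y z * (f z - f y))"
    by (intro sum.cong) (auto simp: generator_def)
  also have "\<dots> = (\<Sum>l | l \<in> activities M \<and> y + transition_vector l \<noteq> y.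
      rate_function M (real_vec y) l * (f (y + transition_vector l) - f y))"
    by (rule sum_rates_density_ctmc[OF M x0 y])
  also have "\<dots> = (\<Sum>l\<in>activities M. rate_function M (real_vec y) l * (f (y + transition_vector l) - f y))"
    using finite_activities[OF M] by (intro sum.mono_neutral_left) auto
  finally show ?thesis .
qed

lemma exit_rate_density_ctmc_le:
  fixes M :: "('p::finite, 'a, 'c) pepa"
  assumes M: "pepa_model M" and x0: "numerical_state x0" and y: "y \<in> states (density_ctmc M x0 n)"
  shows "exit_rate (density_ctmc M x0 n) y \<le> (\<Sum>l\<in>activities M. rate_function M (real_vec y) l)"
proof -
  have "exit_rate (density_ctmc M x0 n) y =
      (\<Sum>l | l \<in> activities M \<and> y + transition_vector l \<noteq> y. rate_function M (real_vec y) l)"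
    using sum_rates_density_ctmc[OF M x0 y, of "\<lambda>_. 1"] by (simp add: exit_rate_def)
  also have "\<dots> \<le> (\<Sum>l\<in>activities M. rate_function M (real_vec y) l)"
    using finite_activities[OF M] states_density_ctmc_invariant(1)[OF M x0 y]
    by (intro sum_mono2) (auto simp: real_vec_nth intro!: rate_function_nonneg[OF M])
  finally show ?thesis .
qed

text \<open>\<open>exp t \<ge> 1 + t\<close> reduces the claim to a linear bound on
  \<open>\<tau> * \<sigma> - C * sqrt \<sigma>\<close>. Completing the square then absorbs
  \<open>C * sqrt \<sigma>\<close> into half of \<open>\<tau> * \<sigma>\<close>, which explains the
  form of \<open>B\<close>.\<close>

lemma bounded_of_exp_sqrt_bound:
  fixes C K \<tau> \<eta> :: real
  assumes "0 < \<tau>" "0 < \<eta>"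
  shows "\<exists>B\<ge>0. \<forall>\<sigma>\<ge>0. \<eta> \<le> K * exp (C * sqrt \<sigma> - \<tau> * \<sigma>) \<longrightarrow> \<sigma> \<le> B"
proof -
  define B where "B = 2 / \<tau> * (\<bar>K\<bar> / \<eta> + C\<^sup>2 / (2 * \<tau>))"
  have "\<sigma> \<le> B" if \<sigma>: "0 \<le> \<sigma>" "\<eta> \<le> K * exp (C * sqrt \<sigma> - \<tau> * \<sigma>)" for \<sigma>
  proof -
    define s where "s = sqrt \<sigma>"
    have s: "s\<^sup>2 = \<sigma>" using \<sigma>(1) by (simp add: s_def)
    have "\<eta> * exp (\<tau> * \<sigma> - C * s) \<le> K * exp (C * s - \<tau> * \<sigma>) * exp (\<tau> * \<sigma> - C * s)"
      using \<sigma>(2) by (intro mult_right_mono) (auto simp: s_def)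
    also have "\<dots> = K" by (simp add: mult.assoc exp_add[symmetric])
    finally have "\<eta> * exp (\<tau> * \<sigma> - C * s) \<le> \<bar>K\<bar>" by simp
    then have "exp (\<tau> * \<sigma> - C * s) \<le> \<bar>K\<bar> / \<eta>" using assms(2) by (simp add: field_simps)
    then have 1: "\<tau> * \<sigma> \<le> \<bar>K\<bar> / \<eta> + C * s"
      using exp_ge_add_one_self[of "\<tau> * \<sigma> - C * s"] by linarith
    have "0 \<le> (\<tau> * s - C)\<^sup>2 / (2 * \<tau>)" using assms(1) by simp
    also have "\<dots> = \<tau> * \<sigma> / 2 + C\<^sup>2 / (2 * \<tau>) - C * s"
      using assms(1) unfolding s[symmetric] by (simp add: field_simps power2_eq_square)
    finally have "\<tau> * \<sigma> / 2 \<le> \<bar>K\<bar> / \<eta> + C\<^sup>2 / (2 * \<tau>)" using 1 by linarith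
    then show ?thesis unfolding B_def using assms(1) by (simp add: field_simps)
  qed
  moreover have "0 \<le> B" unfolding B_def using assms by simp
  ultimately show ?thesis by blast
qed

text \<open>Away from an equilibrium the mean of the linear functional \<open>u\<close> still grows by a fixed fraction of
  \<open>k\<close> between the steps \<open>k\<close> and \<open>2 * k\<close>, that is, between two macroscopic times, although at both
  times it is close to its stationary mean if the spectral gap is large. A constant \<open>N\<close> keeps
  the chain near its initial state during these steps.\<close>

lemma gap_bounded_of_nonequilibrium:
  fixes M :: "('p::finite, 'a, 'c) pepa"
  assumes M: "pepa_model M" and x0: "numerical_state x0"
    and nz: "derived_field M (real_vec x0) \<noteq> 0"
  shows "\<exists>N B. 1 \<le> N \<and> 0 \<le> B \<and> (\<forall>k p Qs. 1 \<le> k \<longrightarrow>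
    reversibilised_chain (states (density_ctmc M x0 (N * k))) p (generator (density_ctmc M x0 (N * k))) Qs \<longrightarrow>
    exp (- C * sqrt (reversibilised_chain.gap (states (density_ctmc M x0 (N * k)))
      (generator (density_ctmc M x0 (N * k))) Qs)) \<le> p (int (N * k) *s x0) \<longrightarrow>
    reversibilised_chain.gap (states (density_ctmc M x0 (N * k)))
      (generator (density_ctmc M x0 (N * k))) Qs \<le> B)"
proof -
  obtain L where L: "0 \<le> L" "\<And>x y. norm (derived_field M x - derived_field M y) \<le> L * norm (x - y)"
    using derived_field_lipschitz[OF M] by blast
  obtain R where R: "0 \<le> R" "\<And>x. (\<Sum>l\<in>activities M. rate_function M x l) \<le> R * norm x"
    using total_rate_le[OF M] by blast
  define u where "u = derived_field M (real_vec x0)"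
  define U where "U = norm u"
  define s where "s = (\<Sum>P\<in>UNIV. real_of_int (x0 $ P))"
  define V where "V = (\<Sum>l\<in>activities M. norm (real_vec (transition_vector l) :: real ^ 'p))"
  \<comment> \<open>\<open>c * n\<close> bounds the total rate out of every state of the
    \<open>n\<close>-th chain; the summand \<open>1\<close> keeps \<open>c\<close> positive.\<close>
  define c where "c = R * s + 1"
  \<comment> \<open>Over \<open>2 * k\<close> steps the drift loses at most
    \<open>U * L * V * \<tau>\<close> per step. \<open>N\<close> makes \<open>\<tau>\<close> so
    small that this is at most \<open>\<eta>\<close>, half of the initial one-step drift
    \<open>U\<^sup>2 / (2 * c)\<close>.\<close>
  define N where "N = nat \<lceil>2 * L * V / U\<rceil> + 1"
  define \<tau> where "\<tau> = 1 / (2 * c * real N)"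
  define \<eta> where "\<eta> = U\<^sup>2 / (4 * c)"
  have U: "0 < U" using nz by (simp add: U_def u_def)
  have s: "0 \<le> s" using x0 unfolding s_def by (intro sum_nonneg) (simp add: numerical_state_def)
  have V: "0 \<le> V" unfolding V_def by (intro sum_nonneg) auto
  have c: "0 < c" using R(1) s by (simp add: c_def add_nonneg_pos)
  have N: "1 \<le> N" "2 * L * V / U \<le> real N" unfolding N_def by linarith+
  have N0: "0 < real N" using N(1) by simp
  have \<tau>: "0 < \<tau>" and \<eta>: "0 < \<eta>" using c N0 U by (simp_all add: \<tau>_def \<eta>_def)
  obtain B where B: "0 \<le> B"
    "\<And>\<sigma>. 0 \<le> \<sigma> \<Longrightarrow> \<eta>\<^sup>2 \<le> 4 * (U * s * real N)\<^sup>2 * exp (C * sqrt \<sigma> - \<tau> * \<sigma>) \<Longrightarrow> \<sigma> \<le> B"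
    using bounded_of_exp_sqrt_bound[OF \<tau> zero_less_power[OF \<eta>, of 2], of "4 * (U * s * real N)\<^sup>2" C] by blast
  show ?thesis
  proof (intro exI[of _ N] exI[of _ B] conjI N(1) B(1) allI impI)
    fix k p Qs
    define n where "n = N * k"
    define S where "S = states (density_ctmc M x0 n)"
    define Q where "Q = generator (density_ctmc M x0 n)"
    assume k: "1 \<le> k"
      and "reversibilised_chain (states (density_ctmc M x0 (N * k))) p
        (generator (density_ctmc M x0 (N * k))) Qs"
      and "exp (- C * sqrt (reversibilised_chain.gap (states (density_ctmc M x0 (N * k)))
        (generator (density_ctmc M x0 (N * k))) Qs)) \<le> p (int (N * k) *s x0)"
    then have chain: "reversibilised_chain S p Q Qs"
      and p: "exp (- C * sqrt (reversibilised_chain.gap S Q Qs)) \<le> p (int n *s x0)"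
      by (simp_all add: S_def Q_def n_def)
    have n: "0 < real n" using k N(1) by (simp add: n_def)
    \<comment> \<open>The largest step size for which the rate bound \<open>c * n\<close> gives
      laziness; \<open>k\<close> steps then take the time \<open>\<tau>\<close>, which does not
      depend on \<open>k\<close>.\<close>
    define h where "h = 1 / (2 * c * real n)"
    have h: "0 < h" using c n by (simp add: h_def)
    have hk: "h * real k = \<tau>" using k by (simp add: h_def \<tau>_def n_def)
    have hcn: "h * (c * real n) = 1 / 2" using c n by (simp add: h_def)
    have nrm: "norm (real_vec y) \<le> real n * s" if "y \<in> S" for y
      using states_density_ctmc_invariant(2)[OF M x0, of y n] that by (simp add: S_def s_def)
    have total: "(\<Sum>l\<in>activities M. rate_function M (real_vec y) l) \<le> c * real n" if "y \<in> S" for y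
    proof -
      have "(\<Sum>l\<in>activities M. rate_function M (real_vec y) l) \<le> R * norm (real_vec y)" by (rule R(2))
      also have "\<dots> \<le> R * (real n * s)" using R(1) nrm[OF that] by (intro mult_left_mono)
      also have "\<dots> \<le> c * real n" by (simp add: c_def algebra_simps)
      finally show ?thesis .
    qed
    interpret lazy_chain S p Q Qs h
    proof (intro lazy_chain.intro lazy_chain_axioms.intro chain h)
      fix y assume y: "y \<in> S"
      have "- Q y y \<le> c * real n"
        using exit_rate_density_ctmc_le[OF M x0, of y n] total[OF y] y
        by (simp add: Q_def S_def generator_def)
      then have "h * - Q y y \<le> h * (c * real n)" using h by (intro mult_left_mono) auto
      then show "h * - Q y y \<le> 1 / 2" using hcn by simp
    qed
    define x where "x = int n *s x0"
    define f where "f y = u \<bullet> real_vec y" for y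
    define g where "g y = norm (real_vec y - real_vec x)" for y
    have x: "x \<in> S" by (simp add: x_def S_def density_ctmc_def)
    have expand: "kernel_op S Q f' y
        = (\<Sum>l\<in>activities M. rate_function M (real_vec y) l * (f' (y + transition_vector l) - f' y))"
      if "y \<in> S" for f' y
      using generator_density_ctmc_expansion[OF M x0, of n p Qs y f'] chain that by (simp add: S_def Q_def)
    \<comment> \<open>The functional \<open>u\<close> is the drift at \<open>x0\<close> itself, so
      the drift of \<open>f\<close> at \<open>x\<close> is \<open>n * U\<^sup>2\<close>; elsewhere
      the Lipschitz bound limits the loss by the distance \<open>g\<close>.\<close>
    have drift_f: "U\<^sup>2 / (2 * c) - (h * U * L) * g y \<le> h * kernel_op S Q f y" if y: "y \<in> S" for y
    proof -
      have "kernel_op S Q f y = u \<bullet> derived_field M (real_vec y)"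
        unfolding expand[OF y] derived_field_def f_def real_vec_add
        by (simp add: inner_add_right inner_sum_right)
      also have "\<dots> = u \<bullet> derived_field M (real_vec x)
          + u \<bullet> (derived_field M (real_vec y) - derived_field M (real_vec x))"
        by (simp add: inner_diff_right)
      also have "u \<bullet> derived_field M (real_vec x) = real n * U\<^sup>2"
        by (simp add: x_def real_vec_smult derived_field_scaleR u_def[symmetric] U_def power2_norm_eq_inner)
      finally have "real n * U\<^sup>2 - \<bar>u \<bullet> (derived_field M (real_vec y) - derived_field M (real_vec x))\<bar>
          \<le> kernel_op S Q f y"
        by linarith
      moreover have "\<bar>u \<bullet> (derived_field M (real_vec y) - derived_field M (real_vec x))\<bar>
          \<le> U * (L * g y)"
        unfolding U_def g_def
        by (intro order_trans[OF Cauchy_Schwarz_ineq2] mult_left_mono L(2)) auto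
      ultimately have "real n * U\<^sup>2 - U * (L * g y) \<le> kernel_op S Q f y" by linarith
      then have "h * (real n * U\<^sup>2 - U * (L * g y)) \<le> h * kernel_op S Q f y"
        using h by (intro mult_left_mono) auto
      moreover have "h * (real n * U\<^sup>2) = U\<^sup>2 / (2 * c)" using n by (simp add: h_def)
      ultimately show ?thesis by (simp add: algebra_simps)
    qed
    have drift_g: "step_op g y \<le> g y + V / 2" if y: "y \<in> S" for y
    proof -
      have "kernel_op S Q g y \<le> (\<Sum>l\<in>activities M. rate_function M (real_vec y) l * V)"
        unfolding expand[OF y]
      proof (intro sum_mono mult_left_mono)
        fix l assume l: "l \<in> activities M"
        have "g (y + transition_vector l) - g y \<le> norm (real_vec (transition_vector l) :: real ^ 'p)"
          unfolding g_def real_vec_add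
          using norm_triangle_ineq2[of "real_vec y + real_vec (transition_vector l) - real_vec x"
              "real_vec y - real_vec x"]
          by simp
        also have "\<dots> \<le> V" unfolding V_def
          using l finite_activities[OF M] by (intro member_le_sum) auto
        finally show "g (y + transition_vector l) - g y \<le> V" .
        show "0 \<le> rate_function M (real_vec y) l"
          using states_density_ctmc_invariant(1)[OF M x0, of y n] y
          by (intro rate_function_nonneg[OF M l]) (auto simp: real_vec_nth S_def)
      qed
      also have "\<dots> \<le> c * real n * V"
        unfolding sum_distrib_right[symmetric] using total[OF y] V by (intro mult_right_mono)
      finally have "h * kernel_op S Q g y \<le> h * (c * real n * V)"
        using h by (intro mult_left_mono) auto
      also have "\<dots> = V / 2" using hcn by (simp add: mult.assoc[symmetric])
      finally show ?thesis by (simp add: step_op_def)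
    qed
    define a where "a j = (step_op ^^ j) f x - mean f" for j
    have growth: "real k * \<eta> \<le> a (k + k) - a k"
    proof -
      have "(h * U * L) * (g x + real (k + k) * (V / 2)) = U * L * V * \<tau>"
        using hk[symmetric] by (simp add: g_def)
      also have "\<dots> \<le> \<eta>"
      proof -
        have "2 * L * V \<le> real N * U" using N(2) U by (simp add: field_simps)
        then have "2 * (U * L * V) \<le> U\<^sup>2 * real N" using U by (simp add: power2_eq_square mult_ac)
        then show ?thesis using c N0 unfolding \<tau>_def \<eta>_def by (simp add: field_simps)
      qed
      finally have "\<eta> \<le> U\<^sup>2 / (2 * c) - (h * U * L) * (g x + real (k + k) * (V / 2))"
        by (simp add: \<eta>_def)
      then have "real k * \<eta> \<le> real k * (U\<^sup>2 / (2 * c) - (h * U * L) * (g x + real (k + k) * (V / 2)))"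
        by (intro mult_left_mono) auto
      also have "\<dots> \<le> (step_op ^^ (k + k)) f x - (step_op ^^ k) f x"
        using h U L(1) V by (intro funpow_step_op_growth drift_f drift_g x) auto
      finally show ?thesis by (simp add: a_def)
    qed
    show "reversibilised_chain.gap (states (density_ctmc M x0 (N * k)))
        (generator (density_ctmc M x0 (N * k))) Qs \<le> B"
      unfolding n_def[symmetric] S_def[symmetric] Q_def[symmetric]
    \<comment> \<open>A negative value satisfies the bound trivially; the sign matters below, where
      \<open>j \<ge> k\<close> steps are estimated by \<open>k\<close> steps.\<close>
    proof (cases "0 \<le> gap")
      case False
      then show "gap \<le> B" using B(1) by simp
    next
      case True
      have f_le: "\<bar>f y\<bar> \<le> U * (real n * s)" if "y \<in> S" for y
        unfolding f_def U_def
        by (intro order_trans[OF Cauchy_Schwarz_ineq2] mult_left_mono nrm that) auto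
      define E where "E = exp (C * sqrt gap - \<tau> * gap) * (U * (real n * s))\<^sup>2"
      have dev: "(a j)\<^sup>2 \<le> E" if j: "k \<le> j" for j
      proof -
        have "exp (- C * sqrt gap) * (a j)\<^sup>2 \<le> p x * (a j)\<^sup>2"
          using p by (intro mult_right_mono) (auto simp: x_def)
        also have "\<dots> \<le> exp (- gap * h * real j) * (U * (real n * s))\<^sup>2"
          unfolding a_def by (rule funpow_step_op_deviation[OF x f_le])
        also have "\<dots> \<le> exp (- \<tau> * gap) * (U * (real n * s))\<^sup>2"
        proof -
          have "gap * (h * real k) \<le> gap * (h * real j)"
            using True h j by (intro mult_left_mono) auto
          then show ?thesis unfolding hk by (intro mult_right_mono) (auto simp: mult_ac)
        qed
        finally have "exp (C * sqrt gap) * (exp (- C * sqrt gap) * (a j)\<^sup>2)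
            \<le> exp (C * sqrt gap) * (exp (- \<tau> * gap) * (U * (real n * s))\<^sup>2)"
          by (intro mult_left_mono) auto
        then show ?thesis
          by (simp add: E_def mult.assoc[symmetric] exp_add[symmetric])
      qed
      have "(real k * \<eta>)\<^sup>2 \<le> (a (k + k) - a k)\<^sup>2"
        using growth \<eta> by (intro power_mono) auto
      also have "\<dots> \<le> 2 * (a (k + k))\<^sup>2 + 2 * (a k)\<^sup>2"
        using zero_le_power2[of "a (k + k) + a k"] by (simp add: power2_eq_square algebra_simps)
      also have "\<dots> \<le> 4 * E" using dev[of k] dev[of "k + k"] by simp
      \<comment> \<open>Since \<open>n = N * k\<close>, both sides carry the factor
        \<open>k\<^sup>2\<close>; cancelling it leaves a bound on the gap uniform in
        \<open>k\<close>.\<close>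
      also have "\<dots> = (real k)\<^sup>2 * (4 * (U * s * real N)\<^sup>2 * exp (C * sqrt gap - \<tau> * gap))"
        by (simp add: E_def n_def power_mult_distrib mult_ac)
      finally have "\<eta>\<^sup>2 \<le> 4 * (U * s * real N)\<^sup>2 * exp (C * sqrt gap - \<tau> * gap)"
        using k by (simp add: power_mult_distrib)
      then show "gap \<le> B" using B(2) True by blast
    qed
  qed
qed

theorem theorem4:
  fixes M :: "('p::finite, 'a, 'c) pepa"
    and x0 :: "int ^ 'p"
    and S :: "nat \<Rightarrow> (int ^ 'p) set"
    and Q Qs :: "nat \<Rightarrow> int ^ 'p \<Rightarrow> int ^ 'p \<Rightarrow> real"
    and p :: "nat \<Rightarrow> int ^ 'p \<Rightarrow> real"
    and \<sigma> :: "nat \<Rightarrow> real"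
    and X :: "real \<Rightarrow> real ^ 'p"
  assumes "pepa_model M"
    and "numerical_state x0"
    and "\<And>n. n \<ge> 1 \<Longrightarrow> irreducible_ctmc (density_ctmc M x0 n)"
    and "\<And>n. n \<ge> 1 \<Longrightarrow> positive_recurrent_ctmc (density_ctmc M x0 n)"
    and "\<And>n. n \<ge> 1 \<Longrightarrow> S n = states (density_ctmc M x0 n)"
    and "\<And>n. n \<ge> 1 \<Longrightarrow> Q n = generator (density_ctmc M x0 n)"
    and "\<And>n. n \<ge> 1 \<Longrightarrow> stationary_distribution (density_ctmc M x0 n) (p n)"
    and "\<And>n. n \<ge> 1 \<Longrightarrow> is_adjoint (S n) (p n) (Q n) (Qs n)"
    and "\<And>n. n \<ge> 1 \<Longrightarrow>
           \<sigma> n = smallest_nonzero_eigenvalue (S n) (\<lambda>x y. - ((Q n x y + Qs n x y) / 2))"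
    and "\<exists>C>0. \<forall>\<^sub>F n in sequentially. Min (p n ` S n) \<ge> exp (- C * sqrt (\<sigma> n))"
    and "solves_derived_odes M X"
    and "X 0 = real_vec x0"
  shows "\<exists>L. (X \<longlongrightarrow> L) at_top"
proof -
  note M = assms(1) and x0 = assms(2)
  have "derived_field M (real_vec x0) = 0"
  proof (rule ccontr)
    assume nz: "derived_field M (real_vec x0) \<noteq> 0"
    obtain C n0 where C: "0 < C" "\<And>n. n0 \<le> n \<Longrightarrow> exp (- C * sqrt (\<sigma> n)) \<le> Min (p n ` S n)"
      using assms(10) by (auto simp: eventually_sequentially)
    have lower: "exp (- C * sqrt (\<sigma> n)) \<le> p n x"
      if "n0 \<le> n" "1 \<le> n" "x \<in> states (density_ctmc M x0 n)" for n x
    proof -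
      have "Min (p n ` S n) \<le> p n x"
        using that assms(5) finite_states_density_ctmc[OF M x0] by auto
      then show ?thesis using C(2)[OF that(1)] by linarith
    qed
    have chain: "reversibilised_chain (states (density_ctmc M x0 n)) (p n)
        (generator (density_ctmc M x0 n)) (Qs n)"
      if n: "n0 \<le> n" "1 \<le> n" for n
    proof (rule density_ctmc_reversibilised[OF M x0])
      show "is_adjoint (states (density_ctmc M x0 n)) (p n) (generator (density_ctmc M x0 n)) (Qs n)"
        using assms(5,6,8) n by metis
      show "0 < p n x" if "x \<in> states (density_ctmc M x0 n)" for x
        using lower[OF n that] by (rule less_le_trans[OF exp_gt_zero])
    qed (use assms(3,7) n in auto)
    have gap: "reversibilised_chain.gap (states (density_ctmc M x0 n))
        (generator (density_ctmc M x0 n)) (Qs n) = \<sigma> n"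
      if n: "n0 \<le> n" "1 \<le> n" for n
      using assms(5,6,9)[OF n(2)]
      by (simp add: reversibilised_chain.gap_def[OF chain[OF n]]
          reversibilised_chain.sym_generator_def[OF chain[OF n], abs_def])
    obtain N B where N: "1 \<le> N" and B: "0 \<le> B"
      "\<And>k p Qs. 1 \<le> k \<Longrightarrow>
        reversibilised_chain (states (density_ctmc M x0 (N * k))) p (generator (density_ctmc M x0 (N * k))) Qs \<Longrightarrow>
        exp (- C * sqrt (reversibilised_chain.gap (states (density_ctmc M x0 (N * k)))
          (generator (density_ctmc M x0 (N * k))) Qs)) \<le> p (int (N * k) *s x0) \<Longrightarrow>
        reversibilised_chain.gap (states (density_ctmc M x0 (N * k)))
          (generator (density_ctmc M x0 (N * k))) Qs \<le> B"
      using gap_bounded_of_nonequilibrium[OF M x0 nz, of C] by metis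
    \<comment> \<open>The summand \<open>n0\<close> reaches the range of the hypothesis, the
      exponential makes \<open>n\<close> exceed the largest possible number of states, and
      \<open>1\<close> ensures \<open>k \<ge> 1\<close>.\<close>
    define k where "k = n0 + nat \<lceil>exp (C * sqrt B)\<rceil> + 1"
    define n where "n = N * k"
    have kn: "k \<le> n" unfolding n_def using mult_le_mono1[OF N, of k] by simp
    then have n: "n0 \<le> n" "1 \<le> n" and n_large: "exp (C * sqrt B) \<le> real n"
      unfolding k_def by linarith+
    let ?S = "states (density_ctmc M x0 n)"
    have "int n *s x0 \<in> ?S" by (simp add: density_ctmc_def)
    then have "\<sigma> n \<le> B"
      using B(2)[of k "p n" "Qs n"] chain[OF n] gap[OF n] lower[OF n, of "int n *s x0"]
      unfolding n_def[symmetric] by (simp add: k_def)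
    then have "exp (- C * sqrt B) \<le> exp (- C * sqrt (\<sigma> n))" using C(1) by simp
    \<comment> \<open>The probabilities sum to \<open>1\<close>, so a uniform lower bound on them
      limits the number of states.\<close>
    then have "(\<Sum>x\<in>?S. exp (- C * sqrt B)) \<le> (\<Sum>x\<in>?S. p n x)"
      using lower[OF n] by (intro sum_mono) (rule order_trans)
    also have "\<dots> = 1" using assms(7)[OF n(2)] by (simp add: stationary_distribution_def)
    finally have "real (card ?S) * exp (- C * sqrt B) \<le> 1" by simp
    then have "real (card ?S) \<le> exp (C * sqrt B)" by (simp add: exp_minus field_simps)
    moreover have "real n < real (card ?S)" using card_states_density_ctmc[OF M x0 nz, of n] by simp
    ultimately show False using n_large by linarith
  qed
  then have eq: "derived_field M (X 0) = 0" using assms(12) by simp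
  obtain L where L: "\<And>x y. norm (derived_field M x - derived_field M y) \<le> L * norm (x - y)"
    using derived_field_lipschitz[OF M] by blast
  have const: "X t = X 0" if "0 \<le> t" for t
    using assms(11)
    by (intro lipschitz_ode_equilibrium_const[where X = X and F = "derived_field M", OF _ L eq that])
      (simp add: solves_derived_odes_def)
  have "\<forall>\<^sub>F t in at_top. X t = X 0"
    using eventually_ge_at_top[of "0::real"] by (rule eventually_mono) (rule const)
  then show ?thesis using tendsto_eventually by blast
qed

end
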